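(* Let $(\mathcal{X},d)$ be a complete separable metric space and $\lambda>0$. Then the space $\mathcal{P}(\mathcal{X})$, metrized by the robust Wasserstein distance $W^{(\lambda)}$, is complete and separable. Moreover, the set of finitely supported probability measures with rational coefficients, i.e. measures $\sum_{j=1}^{N}b_j\delta_{x_j}$ with $N\in\mathbb{N}$, $x_j\in\mathcal{X}$, $b_j\in\mathbb{Q}\cap[0,1]$ and $\sum_j b_j=1$, is dense in $(\mathcal{P}(\mathcal{X}),W^{(\lambda)})$.
   Context: $\mathcal{P}(\mathcal{X})$ is the set of all Borel probability measures on $\mathcal{X}$; $\Pi(\mu,\nu)$ is the set of Borel probability measures on $\mathcal{X}\times\mathcal{X}$ with marginals $\mu$ and $\nu$. The robust Wasserstein distance is the metric $W^{(\lambda)}(\mu,\nu):=\inf_{\pi\in\Pi(\mu,\nu)}\int\min\{d(x,y),2\lambda\}\,d\pi(x,y)$ on $\mathcal{P}(\mathcal{X})$. *)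

theory Defs
  imports "HOL-Probability.Probability"
begin

definition borel_probs :: "'a::topological_space measure set" where
  "borel_probs = {\<mu>. prob_space \<mu> \<and> sets \<mu> = sets borel}"

definition couplings ::
    "'a::topological_space measure \<Rightarrow> 'a measure \<Rightarrow> ('a \<times> 'a) measure set" where
  "couplings \<mu> \<nu> = {\<pi> \<in> borel_probs. distr \<pi> borel fst = \<mu> \<and> distr \<pi> borel snd = \<nu>}"

(* Outside borel_probs there are no couplings, and the infimum of the empty set of reals is
   unspecified. The value 0 is chosen there because the locale Metric_space requires the distance
   function to be nonnegative on the whole type, not only on the carrier. *)
definition robust_wasserstein ::
    "real \<Rightarrow> 'a::metric_space measure \<Rightarrow> 'a measure \<Rightarrow> real" where
  "robust_wasserstein r \<mu> \<nu> =
     (if \<mu> \<in> borel_probs \<and> \<nu> \<in> borel_probs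
      then (INF \<pi>\<in>couplings \<mu> \<nu>. \<integral>z. min (dist (fst z) (snd z)) (2 * r) \<partial>\<pi>)
      else 0)"

(* The identity mu = sum_j b_j delta_(x_j) is stated setwise, as there is no addition on the type
   of measures. The points x_j need not be distinct. *)
definition rational_finite_probs :: "'a::topological_space measure set" where
  "rational_finite_probs =
     {\<mu> \<in> borel_probs. \<exists>(N::nat) (x :: nat \<Rightarrow> 'a) (b :: nat \<Rightarrow> real).
        (\<forall>j\<in>{1..N}. b j \<in> \<rat> \<inter> {0..1}) \<and> (\<Sum>j=1..N. b j) = 1 \<and>
        (\<forall>A\<in>sets borel. measure \<mu> A = (\<Sum>j=1..N. b j * measure (return borel (x j)) A))}"

end

theory Submission
  imports Defs
begin

text \<open>
  Write \<open>c(x, y) = min (d(x, y)) (2r)\<close>. The usual proof that the transport cost for \<open>c\<close> is a complete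
  metric glues couplings along a common marginal, which needs a disintegration theorem. Here the
  gluing is done only up to \<open>\<epsilon>\<close>, where it is elementary: cut the space into countably many Borel cells
  of small diameter, and let a point \<open>x\<close> move to the conditional law of the second coordinate, under a
  coupling \<open>\<pi>\<close> of \<open>\<mu>\<close> and \<open>\<nu>\<close>, given that the first coordinate lies in the cell of \<open>x\<close>. This is a Markov
  kernel that transports \<open>\<mu>\<close> to \<open>\<nu>\<close>; on cells of positive mass it depends on \<open>x\<close> only through the cell.
  Its cost exceeds that of \<open>\<pi>\<close> by an arbitrarily small amount if the cells are small. So the infimum
  that defines the distance may be taken over kernels (\<open>robust_wasserstein_le_kernel\<close> and
  \<open>robust_wasserstein_less_obtains_kernel\<close>), and kernels can be composed.

  \<^item> Composition of two kernels gives the triangle inequality. If the distance of \<open>\<mu>\<close> and \<open>\<nu>\<close> is \<open>0\<close>, then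
    Markov's inequality bounds \<open>\<mu>(F)\<close> by the \<open>\<nu>\<close>-measure of every \<open>\<delta>\<close>-neighbourhood of a closed set \<open>F\<close>,
    hence by \<open>\<nu>(F)\<close>, and closed sets determine a Borel probability measure.
  \<^item> For completeness, pass to a subsequence whose \<open>n\<close>-th consecutive distance is below \<open>(1/2)\<^sup>n\<close>. The
    composition of infinitely many kernels is a Markov chain \<open>X\<close>, which exists by the theorem of
    Ionescu-Tulcea. The expectation of \<open>\<Sum>n. c(X n, X (n + 1))\<close> is finite, so almost every path is a Cauchy
    sequence, and the law of the pathwise limit is the limit of the subsequence
    (\<open>robust_wasserstein_limit_exists\<close>).
  \<^item> For density, move each point to a nearby member of a dense sequence, and collect at one point of
    the sequence the mass that lies in all but finitely many cells or is lost when the weights are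
    rounded down to rationals (\<open>exists_rational_finite_close\<close>). The measures obtained in this way are
    supported on one fixed sequence, so there are only countably many of them.
\<close>

section \<open>Kernels and truncated transport cost\<close>

text \<open>
  The integrand of the transport cost, with values in \<open>ennreal\<close> so that no integrability has to be
  checked when kernels are composed.
\<close>

definition trunc_dist :: "real \<Rightarrow> 'a::metric_space \<Rightarrow> 'a \<Rightarrow> ennreal" where
  "trunc_dist r x y = ennreal (min (dist x y) (2 * r))"

lemma trunc_dist_commute: "trunc_dist r x y = trunc_dist r y x"
  by (simp add: trunc_dist_def dist_commute)

lemma trunc_dist_triangle: 
  assumes "r > 0"
  shows "trunc_dist r x z \<le> trunc_dist r x y + trunc_dist r y z"
proof -
  have "min (dist x z) (2 * r) \<le> min (dist x y) (2 * r) + min (dist y z) (2 * r)"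
    using dist_triangle[of x z y] assms zero_le_dist[of x y] zero_le_dist[of y z] by linarith
  then show ?thesis
    using assms by (simp add: trunc_dist_def flip: ennreal_plus)
qed

lemma trunc_dist_measurable [measurable]:
  fixes f g :: "'b \<Rightarrow> 'a::{metric_space, second_countable_topology}"
  assumes [measurable]: "f \<in> borel_measurable M" "g \<in> borel_measurable M"
  shows "(\<lambda>x. trunc_dist r (f x) (g x)) \<in> borel_measurable M"
  unfolding trunc_dist_def by measurable

lemma borel_probs_eq_space_prob_algebra: "borel_probs = space (prob_algebra borel)"
  by (auto simp: borel_probs_def space_prob_algebra)

lemma emeasure_space_borel_prob:
  assumes "\<mu> \<in> borel_probs"
  shows "emeasure \<mu> UNIV = 1"
proof -
  interpret prob_space \<mu> using assms by (simp add: borel_probs_def)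
  have "space \<mu> = UNIV"
    using assms sets_eq_imp_space_eq[of \<mu> borel] by (simp add: borel_probs_def)
  then show ?thesis using emeasure_space_1 by simp
qed

lemma bind_in_borel_probs:
  assumes "\<mu> \<in> borel_probs" and "K \<in> borel \<rightarrow>\<^sub>M prob_algebra borel"
  shows "\<mu> \<bind> K \<in> borel_probs"
  using assms prob_space_bind'[of \<mu> borel K borel] sets_bind'[of \<mu> borel K borel]
  by (simp add: borel_probs_eq_space_prob_algebra) (simp add: space_prob_algebra)

definition kernel_coupling ::
    "'a::topological_space measure \<Rightarrow> ('a \<Rightarrow> 'a measure) \<Rightarrow> ('a \<times> 'a) measure" where
  "kernel_coupling \<mu> K = \<mu> \<bind> (\<lambda>x. distr (K x) borel (Pair x))"

context
  fixes \<mu> :: "'a::{metric_space, second_countable_topology} measure" and K :: "'a \<Rightarrow> 'a measure"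
  assumes mu: "\<mu> \<in> borel_probs"
    and K [measurable]: "K \<in> borel \<rightarrow>\<^sub>M prob_algebra borel"
begin

private lemma sets_mu [measurable_cong]: "sets \<mu> = sets borel"
  using mu by (simp add: borel_probs_def)

private lemma space_mu: "space \<mu> = UNIV"
  using sets_eq_imp_space_eq[OF sets_mu] by simp

private lemma sets_K [measurable_cong]: "sets (K x) = sets borel"
  using measurable_space[OF K, of x] by (simp add: space_prob_algebra)

private lemma space_K: "space (K x) = UNIV"
  using sets_eq_imp_space_eq[OF sets_K] by simp

private lemma pair_kernel: "(\<lambda>x. distr (K x) borel (Pair x)) \<in> borel \<rightarrow>\<^sub>M prob_algebra borel"
proof -
  have "(\<lambda>(x, y). (x, y)) \<in> borel \<Otimes>\<^sub>M borel \<rightarrow>\<^sub>M (borel :: ('a \<times> 'a) measure)"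
    unfolding borel_prod[symmetric] by measurable
  then show ?thesis
    by (rule measurable_distr_prob_space2[OF K])
qed

lemma kernel_coupling_in_borel_probs: "kernel_coupling \<mu> K \<in> borel_probs"
  unfolding kernel_coupling_def by (rule bind_in_borel_probs[OF mu pair_kernel])

lemma nn_integral_kernel_coupling:
  assumes f [measurable]: "f \<in> borel_measurable borel"
  shows "(\<integral>\<^sup>+z. f z \<partial>kernel_coupling \<mu> K) = (\<integral>\<^sup>+x. \<integral>\<^sup>+y. f (x, y) \<partial>K x \<partial>\<mu>)"
proof -
  have "(\<lambda>x. distr (K x) borel (Pair x)) \<in> \<mu> \<rightarrow>\<^sub>M subprob_algebra (borel :: ('a \<times> 'a) measure)"
    using measurable_prob_algebraD[OF pair_kernel] by (simp cong: measurable_cong_sets add: sets_mu)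
  moreover have "Pair x \<in> K x \<rightarrow>\<^sub>M (borel :: ('a \<times> 'a) measure)" for x
    unfolding borel_prod[symmetric] by measurable
  ultimately show ?thesis
    using f unfolding kernel_coupling_def by (simp add: nn_integral_bind[OF f] nn_integral_distr)
qed

lemma kernel_coupling_in_couplings: "kernel_coupling \<mu> K \<in> couplings \<mu> (\<mu> \<bind> K)"
proof -
  have K': "K \<in> \<mu> \<rightarrow>\<^sub>M subprob_algebra borel"
    by (rule measurable_prob_algebraD) measurable
  have sets_J: "sets (kernel_coupling \<mu> K) = sets borel"
    using kernel_coupling_in_borel_probs by (simp add: borel_probs_def)
  have fstm: "fst \<in> kernel_coupling \<mu> K \<rightarrow>\<^sub>M (borel :: 'a measure)"
   and sndm: "snd \<in> kernel_coupling \<mu> K \<rightarrow>\<^sub>M (borel :: 'a measure)"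
    by (simp_all add: measurable_cong_sets[OF sets_J] borel_prod[symmetric])
  have pre: "kernel_coupling \<mu> K \<in> borel_probs" by (rule kernel_coupling_in_borel_probs)
  have em: "emeasure (distr (kernel_coupling \<mu> K) borel h) A =
      (\<integral>\<^sup>+x. \<integral>\<^sup>+y. indicator A (h (x, y)) \<partial>K x \<partial>\<mu>)"
    if h: "h \<in> kernel_coupling \<mu> K \<rightarrow>\<^sub>M (borel :: 'a measure)" and A[measurable]: "A \<in> sets borel" for h A
  proof -
    note h' = h[unfolded measurable_cong_sets[OF sets_J refl], measurable]
    have "emeasure (distr (kernel_coupling \<mu> K) borel h) A =
       (\<integral>\<^sup>+z. indicator A z \<partial>distr (kernel_coupling \<mu> K) borel h)"
      by simp
    also have "\<dots> = (\<integral>\<^sup>+z. indicator A (h z) \<partial>kernel_coupling \<mu> K)"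
      using h by (intro nn_integral_distr) auto
    finally show ?thesis
      by (simp add: nn_integral_kernel_coupling)
  qed
  have prob_K: "emeasure (K x) UNIV = 1" for x
    using measurable_space[OF K, of x]
    by (intro emeasure_space_borel_prob) (simp add: borel_probs_eq_space_prob_algebra)
  have "distr (kernel_coupling \<mu> K) borel fst = \<mu>"
    using sets_mu by (intro measure_eqI) (auto simp: em[OF fstm] space_K prob_K)
  moreover have "distr (kernel_coupling \<mu> K) borel snd = \<mu> \<bind> K"
    using sets_bind[OF _ , of \<mu> K borel] space_mu
    by (intro measure_eqI) 
       (auto simp: em[OF sndm] emeasure_bind[OF _ K'] sets_K sets_bind[OF sets_kernel[OF K']])
  ultimately show ?thesis
    using pre by (simp add: couplings_def)
qed

end


lemma sets_coupling:
  fixes \<mu> \<nu> :: "'a::{metric_space, second_countable_topology} measure"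
  assumes "\<pi> \<in> couplings \<mu> \<nu>"
  shows "sets \<pi> = sets (borel \<Otimes>\<^sub>M borel)"
  using assms unfolding borel_prod by (simp add: couplings_def borel_probs_def)

text \<open>The product measure, as the coupling of a constant kernel.\<close>

lemma couplings_nonempty:
  fixes \<mu> \<nu> :: "'a::{metric_space, second_countable_topology} measure"
  assumes "\<mu> \<in> borel_probs" "\<nu> \<in> borel_probs"
  shows "couplings \<mu> \<nu> \<noteq> {}"
proof -
  have "(\<lambda>_. \<nu>) \<in> (borel :: 'a measure) \<rightarrow>\<^sub>M prob_algebra borel"
    using assms(2) by (simp add: borel_probs_eq_space_prob_algebra)
  moreover have "\<mu> \<bind> (\<lambda>_. \<nu>) = \<nu>"
    using assms by (intro bind_const') (auto simp: borel_probs_def prob_space_imp_subprob_space)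
  ultimately show ?thesis
    using kernel_coupling_in_couplings[OF assms(1)] by fastforce
qed

section \<open>Bounds for the robust Wasserstein distance\<close>

context
  fixes r :: real and \<pi> :: "('a::{metric_space, second_countable_topology} \<times> 'a) measure"
  assumes r: "r > 0" and pi: "\<pi> \<in> borel_probs"
begin

private lemma measurable_min_dist: "(\<lambda>z. min (dist (fst z) (snd z)) (2 * r)) \<in> borel_measurable \<pi>"
proof -
  have "(\<lambda>z::'a \<times> 'a. min (dist (fst z) (snd z)) (2 * r)) \<in> borel_measurable borel"
    unfolding borel_prod[symmetric] by measurable
  then show ?thesis
    using pi by (simp add: borel_probs_def cong: measurable_cong_sets)
qed

lemma transport_cost_nonneg: "0 \<le> (\<integral>z. min (dist (fst z) (snd z)) (2 * r) \<partial>\<pi>)"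
  using r by simp

lemma ennreal_transport_cost:
  "ennreal (\<integral>z. min (dist (fst z) (snd z)) (2 * r) \<partial>\<pi>) = (\<integral>\<^sup>+z. trunc_dist r (fst z) (snd z) \<partial>\<pi>)"
proof -
  interpret prob_space \<pi> using pi by (simp add: borel_probs_def)
  have "integrable \<pi> (\<lambda>z. min (dist (fst z) (snd z)) (2 * r))"
    using r by (intro integrable_const_bound[of _ "2 * r"] measurable_min_dist) auto
  then show ?thesis
    using r unfolding trunc_dist_def by (intro nn_integral_eq_integral[symmetric]) auto
qed

end

lemma robust_wasserstein_nonneg:
  fixes \<mu> \<nu> :: "'a::{metric_space, second_countable_topology} measure"
  assumes "r > 0"
  shows "0 \<le> robust_wasserstein r \<mu> \<nu>"
  using assms couplings_nonempty[of \<mu> \<nu>] transport_cost_nonneg[of r]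
  by (auto simp: robust_wasserstein_def couplings_def intro!: cINF_greatest)

lemma robust_wasserstein_le:
  fixes \<mu> \<nu> :: "'a::{metric_space, second_countable_topology} measure"
  assumes "r > 0" "\<mu> \<in> borel_probs" "\<nu> \<in> borel_probs" and pi: "\<pi> \<in> couplings \<mu> \<nu>"
    and le: "(\<integral>\<^sup>+z. trunc_dist r (fst z) (snd z) \<partial>\<pi>) \<le> ennreal c" and "0 \<le> c"
  shows "robust_wasserstein r \<mu> \<nu> \<le> c"
proof -
  let ?c = "\<lambda>\<pi>. \<integral>z. min (dist (fst z) (snd z)) (2 * r) \<partial>\<pi>"
  have "bdd_below (?c ` couplings \<mu> \<nu>)"
    using assms(1) transport_cost_nonneg[of r] by (intro bdd_belowI2[of _ 0]) (auto simp: couplings_def)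
  then have "(INF \<pi>\<in>couplings \<mu> \<nu>. ?c \<pi>) \<le> ?c \<pi>"
    using pi by (rule cINF_lower)
  also have "\<dots> \<le> c"
    using le assms(1) pi \<open>0 \<le> c\<close>
    by (simp add: couplings_def flip: ennreal_transport_cost)
  finally show ?thesis
    using assms by (simp add: robust_wasserstein_def)
qed

lemma robust_wasserstein_less_obtains_coupling:
  fixes \<mu> \<nu> :: "'a::{metric_space, second_countable_topology} measure"
  assumes "r > 0" "\<mu> \<in> borel_probs" "\<nu> \<in> borel_probs" and less: "robust_wasserstein r \<mu> \<nu> < c"
  obtains \<pi> where "\<pi> \<in> couplings \<mu> \<nu>" "(\<integral>\<^sup>+z. trunc_dist r (fst z) (snd z) \<partial>\<pi>) < ennreal c"
proof -
  obtain \<pi> where pi: "\<pi> \<in> couplings \<mu> \<nu>"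
      and "(\<integral>z. min (dist (fst z) (snd z)) (2 * r) \<partial>\<pi>) < c"
    using less assms(2,3) couplings_nonempty[of \<mu> \<nu>] 
      cInf_lessD[of "(\<lambda>\<pi>. \<integral>z. min (dist (fst z) (snd z)) (2 * r) \<partial>\<pi>) ` couplings \<mu> \<nu>" c]
    by (auto simp: robust_wasserstein_def)
  moreover have "\<pi> \<in> borel_probs"
    using pi by (simp add: couplings_def)
  ultimately show thesis
    using that[OF pi] transport_cost_nonneg[OF assms(1), of \<pi>] assms(1)
    by (simp add: ennreal_less_iff flip: ennreal_transport_cost)
qed

lemma robust_wasserstein_le_kernel:
  fixes \<mu> :: "'a::{metric_space, second_countable_topology} measure"
  assumes "r > 0" and mu: "\<mu> \<in> borel_probs" and K: "K \<in> borel \<rightarrow>\<^sub>M prob_algebra borel"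
    and "(\<integral>\<^sup>+x. \<integral>\<^sup>+y. trunc_dist r x y \<partial>K x \<partial>\<mu>) \<le> ennreal c" and "0 \<le> c"
  shows "robust_wasserstein r \<mu> (\<mu> \<bind> K) \<le> c"
proof (rule robust_wasserstein_le[OF \<open>r > 0\<close> mu bind_in_borel_probs[OF mu K]
      kernel_coupling_in_couplings[OF mu K] _ \<open>0 \<le> c\<close>])
  have "(\<lambda>z::'a \<times> 'a. trunc_dist r (fst z) (snd z)) \<in> borel_measurable borel"
    unfolding borel_prod[symmetric] by measurable
  then show "(\<integral>\<^sup>+z. trunc_dist r (fst z) (snd z) \<partial>kernel_coupling \<mu> K) \<le> ennreal c"
    using assms by (simp add: nn_integral_kernel_coupling)
qed

section \<open>Couplings are almost given by kernels\<close>

lemma obtain_dense_sequence: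
  obtains e :: "nat \<Rightarrow> 'a::{metric_space, second_countable_topology}"
  where "\<And>x \<epsilon>. \<epsilon> > 0 \<Longrightarrow> \<exists>n. dist x (e n) < \<epsilon>"
proof -
  obtain D :: "'a set" where D: "countable D" "\<And>U. open U \<Longrightarrow> U \<noteq> {} \<Longrightarrow> \<exists>d\<in>D. d \<in> U"
    using countable_dense_setE by blast
  have "\<exists>n. dist x (from_nat_into D n) < \<epsilon>" if "\<epsilon> > 0" for x \<epsilon>
  proof -
    obtain d where "d \<in> D" "dist x d < \<epsilon>"
      using D(2)[of "ball x \<epsilon>"] \<open>\<epsilon> > 0\<close> by auto
    then show ?thesis
      using from_nat_into_surj[OF D(1)] by metis
  qed
  then show thesis using that by blast
qed

text \<open>
  If \<open>e\<close> is dense, the fibres of this map are the cells: countably many Borel sets of diameter at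
  most \<open>2\<epsilon>\<close> that cover the space.
\<close>

definition first_within :: "(nat \<Rightarrow> 'a::metric_space) \<Rightarrow> real \<Rightarrow> 'a \<Rightarrow> nat" where
  "first_within e \<epsilon> x = (LEAST n. dist x (e n) < \<epsilon>)"

lemma dist_first_within:
  "\<exists>n. dist x (e n) < \<epsilon> \<Longrightarrow> dist x (e (first_within e \<epsilon> x)) < \<epsilon>"
  unfolding first_within_def by (rule LeastI_ex)

lemma measurable_first_within [measurable]:
  "first_within e \<epsilon> \<in> (borel :: 'a::{metric_space, second_countable_topology} measure) \<rightarrow>\<^sub>M count_space UNIV"
  unfolding first_within_def by measurable

lemma nn_integral_split_nat:
  fixes T :: "'a \<Rightarrow> nat"
  assumes [measurable]: "T \<in> M \<rightarrow>\<^sub>M count_space UNIV" "\<And>i. f i \<in> borel_measurable M"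
  shows "(\<integral>\<^sup>+x. f (T x) x \<partial>M) = (\<Sum>i. \<integral>\<^sup>+x. f i x * indicator {x \<in> space M. T x = i} x \<partial>M)"
proof -
  have "f (T x) x = (\<Sum>i. f i x * indicator {x \<in> space M. T x = i} x)" if "x \<in> space M" for x
    using that by (subst suminf_finite[of "{T x}"]) auto
  then have "(\<integral>\<^sup>+x. f (T x) x \<partial>M) = (\<integral>\<^sup>+x. (\<Sum>i. f i x * indicator {x \<in> space M. T x = i} x) \<partial>M)"
    by (intro nn_integral_cong) simp
  also have "\<dots> = (\<Sum>i. \<integral>\<^sup>+x. f i x * indicator {x \<in> space M. T x = i} x \<partial>M)"
    by (intro nn_integral_suminf) measurable
  finally show ?thesis .
qed

text \<open>
  The conditional law under \<open>\<pi>\<close> of the second coordinate, given that the first lies in the cell of \<open>x\<close>;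
  \<open>T\<close> assigns to each point the index of its cell. On a cell of measure zero the point mass at \<open>x\<close> is an
  arbitrary choice, made to have a probability measure everywhere.
\<close>

definition cell_kernel ::
    "('a::topological_space \<times> 'a) measure \<Rightarrow> ('a \<Rightarrow> nat) \<Rightarrow> 'a \<Rightarrow> 'a measure" where
  "cell_kernel \<pi> T x = 
     (let S = {z. T (fst z) = T x}
      in if emeasure \<pi> S = 0 then return borel x else distr (uniform_measure \<pi> S) borel snd)"

context
  fixes \<mu> \<nu> :: "'a::{metric_space, second_countable_topology} measure" and \<pi> and T :: "'a \<Rightarrow> nat"
  assumes pi: "\<pi> \<in> couplings \<mu> \<nu>" and T [measurable]: "T \<in> borel \<rightarrow>\<^sub>M count_space UNIV"
begin

private lemma sets_pi [measurable_cong]: "sets \<pi> = sets (borel \<Otimes>\<^sub>M borel)"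
  by (rule sets_coupling[OF pi])

private lemma space_pi: "space \<pi> = UNIV"
  using sets_eq_imp_space_eq[OF sets_pi] by (simp add: space_pair_measure)

private definition "S i = {z :: 'a \<times> 'a. T (fst z) = i}" 

private lemma sets_S [measurable]: "S i \<in> sets \<pi>"
proof -
  have "{z \<in> space (borel \<Otimes>\<^sub>M borel). T (fst z) = i} \<in> sets (borel \<Otimes>\<^sub>M borel :: ('a \<times> 'a) measure)"
    by measurable
  then show ?thesis by (simp add: S_def sets_pi space_pair_measure)
qed

private lemma finite_pi: "emeasure \<pi> (S i) \<noteq> \<infinity>"
proof -
  interpret prob_space \<pi> using pi by (simp add: couplings_def borel_probs_def)
  show ?thesis by simp
qed

private lemma snd_uniform: "snd \<in> uniform_measure \<pi> (S i) \<rightarrow>\<^sub>M (borel :: 'a measure)"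
  unfolding measurable_cong_sets[OF trans[OF sets_uniform_measure sets_pi] refl] by measurable

private lemma cell_kernel_eq:
  "cell_kernel \<pi> T x = (if emeasure \<pi> (S (T x)) = 0 then return borel x
     else distr (uniform_measure \<pi> (S (T x))) borel snd)"
  by (simp add: cell_kernel_def S_def)

lemma cell_kernel_measurable: "cell_kernel \<pi> T \<in> borel \<rightarrow>\<^sub>M prob_algebra borel"
proof -
  define L where "L i x = (if emeasure \<pi> (S i) = 0 then return borel x
     else distr (uniform_measure \<pi> (S i)) borel snd)" for i x
  have "L i \<in> borel \<rightarrow>\<^sub>M prob_algebra borel" for i
  proof (cases "emeasure \<pi> (S i) = 0")
    case True
    then show ?thesis by (simp add: L_def[abs_def] measurable_return_prob_space)
  next
    case False
    then have "prob_space (distr (uniform_measure \<pi> (S i)) borel snd)"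
      using finite_pi snd_uniform by (intro prob_space.prob_space_distr prob_space_uniform_measure) auto
    then show ?thesis
      using False by (simp add: L_def[abs_def] space_prob_algebra)
  qed
  then have "(\<lambda>x. L (T x) x) \<in> borel \<rightarrow>\<^sub>M prob_algebra borel"
    by (rule measurable_compose_countable) (rule T)
  then show ?thesis
    by (simp add: L_def cell_kernel_eq[abs_def])
qed

text \<open>
  An integrand that sees the first coordinate only through its cell cannot distinguish \<open>\<pi>\<close> from the
  coupling that the kernel induces. On a cell \<open>i\<close> of positive mass the inner integral on the left is
  the integral over the event \<open>T = i\<close> divided by the mass of this event, and the outer integral
  multiplies by the mass again.
\<close>

lemma nn_integral_cell_kernel:
  assumes h [measurable]: "\<And>i. h i \<in> borel_measurable borel"
  shows "(\<integral>\<^sup>+x. \<integral>\<^sup>+y. h (T x) y \<partial>cell_kernel \<pi> T x \<partial>\<mu>) = (\<integral>\<^sup>+z. h (T (fst z)) (snd z) \<partial>\<pi>)"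
proof -
  have mu: "\<mu> = distr \<pi> borel fst" using pi by (simp add: couplings_def)
  have [measurable]: "fst \<in> \<pi> \<rightarrow>\<^sub>M (borel :: 'a measure)" "snd \<in> \<pi> \<rightarrow>\<^sub>M (borel :: 'a measure)"
    by (simp_all add: measurable_cong_sets[OF sets_pi])
  have [measurable]: "(\<lambda>z. T (fst z)) \<in> \<pi> \<rightarrow>\<^sub>M count_space UNIV" by measurable
  have inner [measurable]: "(\<lambda>x. \<integral>\<^sup>+y. h i y \<partial>cell_kernel \<pi> T x) \<in> borel_measurable borel" for i
    by (rule nn_integral_measurable_subprob_algebra2[OF _ measurable_prob_algebraD[OF cell_kernel_measurable]])
       measurable
  have S': "{z \<in> space \<pi>. T (fst z) = i} = S i" for i
    by (auto simp: S_def space_pi)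
  have "(\<integral>\<^sup>+x. \<integral>\<^sup>+y. h (T x) y \<partial>cell_kernel \<pi> T x \<partial>\<mu>) =
      (\<integral>\<^sup>+z. (\<integral>\<^sup>+y. h (T (fst z)) y \<partial>cell_kernel \<pi> T (fst z)) \<partial>\<pi>)"
    unfolding mu by (rule nn_integral_distr) (simp_all add: measurable_compose_countable[OF inner T])
  also have "\<dots> = (\<Sum>i. \<integral>\<^sup>+z. (\<integral>\<^sup>+y. h i y \<partial>cell_kernel \<pi> T (fst z)) * indicator (S i) z \<partial>\<pi>)"
    unfolding S'[symmetric]
    by (rule nn_integral_split_nat[where f="\<lambda>i z. \<integral>\<^sup>+y. h i y \<partial>cell_kernel \<pi> T (fst z)"]) measurable
  also have "\<dots> = (\<Sum>i. \<integral>\<^sup>+z. h i (snd z) * indicator (S i) z \<partial>\<pi>)"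
  proof (rule suminf_cong)
    fix i
    show "(\<integral>\<^sup>+z. (\<integral>\<^sup>+y. h i y \<partial>cell_kernel \<pi> T (fst z)) * indicator (S i) z \<partial>\<pi>) =
      (\<integral>\<^sup>+z. h i (snd z) * indicator (S i) z \<partial>\<pi>)"
    proof (cases "emeasure \<pi> (S i) = 0")
      case True
      then show ?thesis
        by (simp add: nn_integral_null_set null_setsI)
    next
      case False
      let ?I = "\<integral>\<^sup>+z. h i (snd z) * indicator (S i) z \<partial>\<pi>"
      have "(\<integral>\<^sup>+y. h i y \<partial>cell_kernel \<pi> T x) = ?I / emeasure \<pi> (S i)" if "T x = i" for x
        using that False
        by (simp add: cell_kernel_eq nn_integral_distr[OF snd_uniform] nn_integral_uniform_measure)
      then have "(\<integral>\<^sup>+z. (\<integral>\<^sup>+y. h i y \<partial>cell_kernel \<pi> T (fst z)) * indicator (S i) z \<partial>\<pi>) =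
         (\<integral>\<^sup>+z. ?I / emeasure \<pi> (S i) * indicator (S i) z \<partial>\<pi>)"
        by (intro nn_integral_cong) (simp add: S_def split: split_indicator)
      also have "\<dots> = ?I"
        using False finite_pi[of i]
        by (subst nn_integral_cmult_indicator)
           (simp_all add: ennreal_divide_times ennreal_divide_self less_top)
      finally show ?thesis .
    qed
  qed
  also have "\<dots> = (\<integral>\<^sup>+z. h (T (fst z)) (snd z) \<partial>\<pi>)"
    unfolding S'[symmetric]
    by (rule nn_integral_split_nat[where f="\<lambda>i z. h i (snd z)", symmetric]) measurable
  finally show ?thesis .
qed

lemma bind_cell_kernel: "\<mu> \<bind> cell_kernel \<pi> T = \<nu>"
proof (rule measure_eqI)
  have sets_mu: "sets \<mu> = sets borel" and nu: "\<nu> = distr \<pi> borel snd"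
    using pi by (auto simp: couplings_def)
  have space_mu: "space \<mu> \<noteq> {}"
    using sets_eq_imp_space_eq[OF sets_mu] by simp
  have K: "cell_kernel \<pi> T \<in> \<mu> \<rightarrow>\<^sub>M subprob_algebra borel"
    using measurable_prob_algebraD[OF cell_kernel_measurable] by (simp cong: measurable_cong_sets add: sets_mu)
  show sets_eq: "sets (\<mu> \<bind> cell_kernel \<pi> T) = sets \<nu>"
    using sets_bind[OF sets_kernel[OF K] space_mu] by (simp add: nu)
  fix A assume "A \<in> sets (\<mu> \<bind> cell_kernel \<pi> T)"
  then have A [measurable]: "A \<in> sets borel"
    using sets_eq nu by simp
  have [measurable]: "snd \<in> \<pi> \<rightarrow>\<^sub>M (borel :: 'a measure)"
    by (simp_all add: measurable_cong_sets[OF sets_pi])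
  have "emeasure (\<mu> \<bind> cell_kernel \<pi> T) A = (\<integral>\<^sup>+x. \<integral>\<^sup>+y. indicator A y \<partial>cell_kernel \<pi> T x \<partial>\<mu>)"
    using sets_kernel[OF K] sets_eq_imp_space_eq[OF sets_mu]
    by (simp add: emeasure_bind[OF space_mu K A])
  also have "\<dots> = (\<integral>\<^sup>+z. indicator A (snd z) \<partial>\<pi>)"
    by (rule nn_integral_cell_kernel[where h="\<lambda>_. indicator A"]) measurable
  also have "\<dots> = (\<integral>\<^sup>+y. indicator A y \<partial>\<nu>)"
    unfolding nu by (rule nn_integral_distr[symmetric]) simp_all
  finally show "emeasure (\<mu> \<bind> cell_kernel \<pi> T) A = emeasure \<nu> A"
    by (simp add: nu)
qed

end

text \<open>
  Replacing the first argument of the cost by the chosen point of its cell makes the integrand depend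
  on that argument through its cell only. This is done once under the kernel and undone once under
  \<open>\<pi>\<close>, at a price of \<open>\<epsilon>\<close> each time.
\<close>

lemma nn_integral_trunc_dist_cell_kernel_le:
  fixes \<mu> \<nu> :: "'a::{metric_space, second_countable_topology} measure"
  assumes r: "r > 0" and eps: "\<epsilon> > 0" and pi: "\<pi> \<in> couplings \<mu> \<nu>"
    and e: "\<And>x. \<exists>n. dist x (e n) < \<epsilon>"
  shows "(\<integral>\<^sup>+x. \<integral>\<^sup>+y. trunc_dist r x y \<partial>cell_kernel \<pi> (first_within e \<epsilon>) x \<partial>\<mu>)
     \<le> (\<integral>\<^sup>+z. trunc_dist r (fst z) (snd z) \<partial>\<pi>) + ennreal (2 * \<epsilon>)"
proof -
  let ?T = "first_within e \<epsilon>"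
  have near: "trunc_dist r x (e (?T x)) \<le> ennreal \<epsilon>" for x
    using dist_first_within[OF e, of x] by (auto simp: trunc_dist_def intro!: ennreal_leI)
  interpret pi: prob_space \<pi> using pi by (simp add: couplings_def borel_probs_def)
  have sets_pi [measurable_cong]: "sets \<pi> = sets (borel \<Otimes>\<^sub>M borel)"
    by (rule sets_coupling[OF pi])
  have [measurable]: "fst \<in> \<pi> \<rightarrow>\<^sub>M (borel :: 'a measure)" "snd \<in> \<pi> \<rightarrow>\<^sub>M (borel :: 'a measure)"
    by (simp_all add: measurable_cong_sets[OF sets_pi])
  have "trunc_dist r x y \<le> ennreal \<epsilon> + trunc_dist r (e (?T x)) y" for x y
    using trunc_dist_triangle[OF r, of x y "e (?T x)"] near[of x]
    by (meson add_mono order_refl order_trans)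
  then have "(\<integral>\<^sup>+x. \<integral>\<^sup>+y. trunc_dist r x y \<partial>cell_kernel \<pi> ?T x \<partial>\<mu>)
    \<le> (\<integral>\<^sup>+x. \<integral>\<^sup>+y. ennreal \<epsilon> + trunc_dist r (e (?T x)) y \<partial>cell_kernel \<pi> ?T x \<partial>\<mu>)"
    by (intro nn_integral_mono) simp
  also have "\<dots> = (\<integral>\<^sup>+z. ennreal \<epsilon> + trunc_dist r (e (?T (fst z))) (snd z) \<partial>\<pi>)"
    by (rule nn_integral_cell_kernel[OF pi, where h="\<lambda>i y. ennreal \<epsilon> + trunc_dist r (e i) y"]) measurable
  also have "\<dots> \<le> (\<integral>\<^sup>+z. trunc_dist r (fst z) (snd z) + ennreal (2 * \<epsilon>) \<partial>\<pi>)"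
  proof (rule nn_integral_mono)
    fix z
    have "trunc_dist r (e (?T (fst z))) (snd z) \<le> ennreal \<epsilon> + trunc_dist r (fst z) (snd z)"
      using trunc_dist_triangle[OF r, of "e (?T (fst z))" "snd z" "fst z"] near[of "fst z"]
      by (subst (asm) (2) trunc_dist_commute) (meson add_mono order_refl order_trans)
    then have "ennreal \<epsilon> + trunc_dist r (e (?T (fst z))) (snd z) \<le> ennreal \<epsilon> + (ennreal \<epsilon> + trunc_dist r (fst z) (snd z))"
      by (rule add_left_mono)
    also have "\<dots> = trunc_dist r (fst z) (snd z) + ennreal (2 * \<epsilon>)"
      using eps by (simp add: ac_simps flip: ennreal_plus)
    finally show "ennreal \<epsilon> + trunc_dist r (e (?T (fst z))) (snd z) \<le> trunc_dist r (fst z) (snd z) + ennreal (2 * \<epsilon>)" .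
  qed
  also have "\<dots> = (\<integral>\<^sup>+z. trunc_dist r (fst z) (snd z) \<partial>\<pi>) + ennreal (2 * \<epsilon>)"
    by (subst nn_integral_add) (auto simp: pi.emeasure_space_1)
  finally show ?thesis .
qed

text \<open>
  The gap between the distance and \<open>c\<close> leaves room for a nearly optimal coupling and for its
  replacement by a kernel.
\<close>

lemma robust_wasserstein_less_obtains_kernel:
  fixes \<mu> \<nu> :: "'a::{metric_space, second_countable_topology} measure"
  assumes r: "r > 0" and "\<mu> \<in> borel_probs" "\<nu> \<in> borel_probs" and "robust_wasserstein r \<mu> \<nu> < c"
  obtains K where "K \<in> borel \<rightarrow>\<^sub>M prob_algebra borel" "\<mu> \<bind> K = \<nu>"
    "(\<integral>\<^sup>+x. \<integral>\<^sup>+y. trunc_dist r x y \<partial>K x \<partial>\<mu>) \<le> ennreal c"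
proof -
  obtain c' where c': "robust_wasserstein r \<mu> \<nu> < c'" "c' < c"
    using assms(4) dense by blast
  have "0 < c'" using robust_wasserstein_nonneg[OF r, of \<mu> \<nu>] c' by simp
  obtain \<pi> where pi: "\<pi> \<in> couplings \<mu> \<nu>"
      and cost: "(\<integral>\<^sup>+z. trunc_dist r (fst z) (snd z) \<partial>\<pi>) < ennreal c'"
    using robust_wasserstein_less_obtains_coupling[OF r assms(2,3) c'(1)] by blast
  obtain e :: "nat \<Rightarrow> 'a" where e: "\<And>x \<epsilon>. \<epsilon> > 0 \<Longrightarrow> \<exists>n. dist x (e n) < \<epsilon>"
    using obtain_dense_sequence by blast
  define \<epsilon> where "\<epsilon> = (c - c') / 2"
  let ?K = "cell_kernel \<pi> (first_within e \<epsilon>)"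
  have "\<epsilon> > 0" using c' by (simp add: \<epsilon>_def)
  then have "(\<integral>\<^sup>+x. \<integral>\<^sup>+y. trunc_dist r x y \<partial>?K x \<partial>\<mu>)
      \<le> (\<integral>\<^sup>+z. trunc_dist r (fst z) (snd z) \<partial>\<pi>) + ennreal (2 * \<epsilon>)"
    using e by (intro nn_integral_trunc_dist_cell_kernel_le[OF r _ pi]) auto
  also have "\<dots> \<le> ennreal c' + ennreal (2 * \<epsilon>)"
    using cost by (intro add_right_mono) simp
  also have "\<dots> = ennreal c"
    using \<open>0 < c'\<close> c' by (simp add: \<epsilon>_def field_simps flip: ennreal_plus)
  finally show thesis
    using that[OF cell_kernel_measurable[OF pi] bind_cell_kernel[OF pi], OF measurable_first_within measurable_first_within]
    by simp
qed

section \<open>The robust Wasserstein distance is a metric\<close>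

lemma robust_wasserstein_refl:
  fixes \<mu> :: "'a::{metric_space, second_countable_topology} measure"
  assumes r: "r > 0" and mu: "\<mu> \<in> borel_probs"
  shows "robust_wasserstein r \<mu> \<mu> = 0"
proof -
  have K: "return borel \<in> (borel :: 'a measure) \<rightarrow>\<^sub>M prob_algebra borel"
    by (rule measurable_return_prob_space)
  have "\<mu> \<bind> return borel = \<mu>"
    using mu by (intro bind_return'') (simp add: borel_probs_def)
  moreover have "(\<integral>\<^sup>+x. \<integral>\<^sup>+y. trunc_dist r x y \<partial>return borel x \<partial>\<mu>) = 0"
    using r by (simp add: nn_integral_return trunc_dist_def)
  ultimately have "robust_wasserstein r \<mu> \<mu> \<le> 0"
    using robust_wasserstein_le_kernel[OF r mu K, of 0] by simp
  then show ?thesis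
    using robust_wasserstein_nonneg[OF r, of \<mu> \<mu>] by simp
qed

lemma robust_wasserstein_le_commute:
  fixes \<mu> \<nu> :: "'a::{metric_space, second_countable_topology} measure"
  assumes r: "r > 0"
  shows "robust_wasserstein r \<mu> \<nu> \<le> robust_wasserstein r \<nu> \<mu>"
proof (cases "\<mu> \<in> borel_probs \<and> \<nu> \<in> borel_probs")
  case True
  then have mu: "\<mu> \<in> borel_probs" and nu: "\<nu> \<in> borel_probs" by auto
  show ?thesis
  proof (rule dense_ge)
    fix c assume "robust_wasserstein r \<nu> \<mu> < c"
    then obtain \<pi> where pi: "\<pi> \<in> couplings \<nu> \<mu>"
      and cost: "(\<integral>\<^sup>+z. trunc_dist r (fst z) (snd z) \<partial>\<pi>) < ennreal c"
      using robust_wasserstein_less_obtains_coupling[OF r nu mu] by blast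
    have "0 \<le> c"
      using \<open>_ < c\<close> robust_wasserstein_nonneg[OF r, of \<nu> \<mu>] by simp
    have [measurable]: "fst \<in> \<pi> \<rightarrow>\<^sub>M (borel :: 'a measure)" "snd \<in> \<pi> \<rightarrow>\<^sub>M (borel :: 'a measure)"
      by (simp_all add: measurable_cong_sets[OF sets_coupling[OF pi]])
    have swap [measurable]: "(\<lambda>z. (snd z, fst z)) \<in> \<pi> \<rightarrow>\<^sub>M (borel :: ('a \<times> 'a) measure)"
      unfolding borel_prod[symmetric] by measurable
    have proj [measurable]: "(fst :: 'a \<times> 'a \<Rightarrow> 'a) \<in> borel \<rightarrow>\<^sub>M borel"
        "(snd :: 'a \<times> 'a \<Rightarrow> 'a) \<in> borel \<rightarrow>\<^sub>M borel"
      unfolding borel_prod[symmetric] by measurable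
    let ?\<pi>' = "distr \<pi> borel (\<lambda>z. (snd z, fst z))"
    have "?\<pi>' \<in> couplings \<mu> \<nu>"
      using pi prob_space.prob_space_distr[OF _ swap]
      by (simp add: couplings_def borel_probs_def distr_distr o_def)
    moreover have "(\<integral>\<^sup>+z. trunc_dist r (fst z) (snd z) \<partial>?\<pi>') = (\<integral>\<^sup>+z. trunc_dist r (fst z) (snd z) \<partial>\<pi>)"
      by (subst nn_integral_distr) (simp_all add: trunc_dist_commute)
    ultimately show "robust_wasserstein r \<mu> \<nu> \<le> c"
      using cost by (intro robust_wasserstein_le[OF r mu nu _ _ \<open>0 \<le> c\<close>]) auto
  qed
qed (auto simp: robust_wasserstein_def)

text \<open>
  Nearly optimal kernels from \<open>\<mu>\<close> to \<open>\<nu>\<close> and from \<open>\<nu>\<close> to \<open>\<rho>\<close> compose to a kernel from \<open>\<mu>\<close> to \<open>\<rho>\<close>. The triangle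
  inequality for the truncated distance bounds its cost by the sum, because the intermediate point
  has law \<open>\<nu>\<close>.
\<close>

lemma robust_wasserstein_triangle:
  fixes \<mu> \<nu> \<rho> :: "'a::{metric_space, second_countable_topology} measure"
  assumes r: "r > 0" and mu: "\<mu> \<in> borel_probs" and nu: "\<nu> \<in> borel_probs" and rho: "\<rho> \<in> borel_probs"
  shows "robust_wasserstein r \<mu> \<rho> \<le> robust_wasserstein r \<mu> \<nu> + robust_wasserstein r \<nu> \<rho>"
proof (rule field_le_epsilon)
  fix \<delta> :: real assume delta: "\<delta> > 0"
  define a where "a = robust_wasserstein r \<mu> \<nu> + \<delta> / 2"
  define b where "b = robust_wasserstein r \<nu> \<rho> + \<delta> / 2"
  have ab: "0 \<le> a" "0 \<le> b"
    using robust_wasserstein_nonneg[OF r, of \<mu> \<nu>] robust_wasserstein_nonneg[OF r, of \<nu> \<rho>] delta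
    by (simp_all add: a_def b_def)
  have less: "robust_wasserstein r \<mu> \<nu> < a" "robust_wasserstein r \<nu> \<rho> < b"
    using delta by (simp_all add: a_def b_def)
  obtain K where K: "K \<in> borel \<rightarrow>\<^sub>M prob_algebra borel" and mu_K: "\<mu> \<bind> K = \<nu>"
      and cost_K: "(\<integral>\<^sup>+x. \<integral>\<^sup>+y. trunc_dist r x y \<partial>K x \<partial>\<mu>) \<le> ennreal a"
    by (rule robust_wasserstein_less_obtains_kernel[OF r mu nu less(1)])
  obtain L where L: "L \<in> borel \<rightarrow>\<^sub>M prob_algebra borel" and nu_L: "\<nu> \<bind> L = \<rho>"
      and cost_L: "(\<integral>\<^sup>+x. \<integral>\<^sup>+y. trunc_dist r x y \<partial>L x \<partial>\<nu>) \<le> ennreal b"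
    by (rule robust_wasserstein_less_obtains_kernel[OF r nu rho less(2)])
  have sets_mu [measurable_cong]: "sets \<mu> = sets borel"
    using mu by (simp add: borel_probs_def)
  note K' = measurable_prob_algebraD[OF K] and L' = measurable_prob_algebraD[OF L]
  note [measurable] = K' L'
  have K_mu: "K \<in> \<mu> \<rightarrow>\<^sub>M subprob_algebra borel"
    using K' by (simp add: measurable_cong_sets[OF sets_mu refl])
  have K_in: "K x \<in> borel_probs" and L_in: "L x \<in> borel_probs" for x
    using measurable_space[OF K, of x] measurable_space[OF L, of x]
    by (simp_all add: borel_probs_eq_space_prob_algebra)
  have sets_K [measurable_cong]: "sets (K x) = sets borel" 
    and sets_L [measurable_cong]: "sets (L x) = sets borel" for x
    using K_in[of x] L_in[of x] by (simp_all add: borel_probs_def)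
  have L_K: "L \<in> K x \<rightarrow>\<^sub>M subprob_algebra borel" for x
    using L' by (simp add: measurable_cong_sets[OF sets_K refl])
  have space_KL: "emeasure (K x) (space (K x)) = 1" "emeasure (L x) (space (L x)) = 1" for x
    using K_in[of x] L_in[of x] by (auto simp: borel_probs_def prob_space.emeasure_space_1)
  let ?KL = "\<lambda>x. K x \<bind> L"
  have KL: "?KL \<in> borel \<rightarrow>\<^sub>M prob_algebra borel"
    by (rule measurable_bind_prob_space[OF K L])
  have "\<mu> \<bind> ?KL = \<rho>"
    using bind_assoc[OF K_mu L'] mu_K nu_L by simp
  moreover have "(\<integral>\<^sup>+x. \<integral>\<^sup>+z. trunc_dist r x z \<partial>?KL x \<partial>\<mu>) \<le> ennreal (a + b)"
  proof -
    have [measurable]: "(\<lambda>y. \<integral>\<^sup>+z. trunc_dist r y z \<partial>L y) \<in> borel_measurable borel"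
      by (rule nn_integral_measurable_subprob_algebra2[OF _ L']) measurable
    have [measurable]: "(\<lambda>x. \<integral>\<^sup>+y. trunc_dist r x y \<partial>K x) \<in> borel_measurable borel"
      by (rule nn_integral_measurable_subprob_algebra2[OF _ K']) measurable
    have [measurable]: "(\<lambda>x. \<integral>\<^sup>+y. \<integral>\<^sup>+z. trunc_dist r y z \<partial>L y \<partial>K x) \<in> borel_measurable borel"
      by (rule nn_integral_measurable_subprob_algebra2[OF _ K']) measurable
    have "(\<integral>\<^sup>+z. trunc_dist r x z \<partial>?KL x) 
        \<le> (\<integral>\<^sup>+y. trunc_dist r x y \<partial>K x) + (\<integral>\<^sup>+y. \<integral>\<^sup>+z. trunc_dist r y z \<partial>L y \<partial>K x)" for x
    proof -
      have "(\<integral>\<^sup>+z. trunc_dist r x z \<partial>?KL x) = (\<integral>\<^sup>+y. \<integral>\<^sup>+z. trunc_dist r x z \<partial>L y \<partial>K x)"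
        by (rule nn_integral_bind[OF _ L_K]) measurable
      also have "\<dots> \<le> (\<integral>\<^sup>+y. \<integral>\<^sup>+z. trunc_dist r x y + trunc_dist r y z \<partial>L y \<partial>K x)"
        by (intro nn_integral_mono trunc_dist_triangle r)
      also have "\<dots> = (\<integral>\<^sup>+y. trunc_dist r x y + (\<integral>\<^sup>+z. trunc_dist r y z \<partial>L y) \<partial>K x)"
        by (intro nn_integral_cong, subst nn_integral_add)
           (auto simp: space_KL measurable_cong_sets[OF sets_L refl])
      also have "\<dots> = (\<integral>\<^sup>+y. trunc_dist r x y \<partial>K x) + (\<integral>\<^sup>+y. \<integral>\<^sup>+z. trunc_dist r y z \<partial>L y \<partial>K x)"
        by (rule nn_integral_add) (simp_all add: measurable_cong_sets[OF sets_K refl])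
      finally show ?thesis .
    qed
    then have "(\<integral>\<^sup>+x. \<integral>\<^sup>+z. trunc_dist r x z \<partial>?KL x \<partial>\<mu>)
       \<le> (\<integral>\<^sup>+x. (\<integral>\<^sup>+y. trunc_dist r x y \<partial>K x) + (\<integral>\<^sup>+y. \<integral>\<^sup>+z. trunc_dist r y z \<partial>L y \<partial>K x) \<partial>\<mu>)"
      by (intro nn_integral_mono)
    also have "\<dots> = (\<integral>\<^sup>+x. \<integral>\<^sup>+y. trunc_dist r x y \<partial>K x \<partial>\<mu>) + (\<integral>\<^sup>+x. \<integral>\<^sup>+y. \<integral>\<^sup>+z. trunc_dist r y z \<partial>L y \<partial>K x \<partial>\<mu>)"
      by (rule nn_integral_add) (simp_all add: measurable_cong_sets[OF sets_mu refl])
    also have "(\<integral>\<^sup>+x. \<integral>\<^sup>+y. \<integral>\<^sup>+z. trunc_dist r y z \<partial>L y \<partial>K x \<partial>\<mu>) = (\<integral>\<^sup>+y. \<integral>\<^sup>+z. trunc_dist r y z \<partial>L y \<partial>\<nu>)"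
      unfolding mu_K[symmetric] by (rule nn_integral_bind[OF _ K_mu, symmetric]) measurable
    also have "(\<integral>\<^sup>+x. \<integral>\<^sup>+y. trunc_dist r x y \<partial>K x \<partial>\<mu>) + \<dots> \<le> ennreal a + ennreal b"
      by (rule add_mono[OF cost_K cost_L])
    finally show ?thesis
      using ab by simp
  qed
  ultimately have "robust_wasserstein r \<mu> \<rho> \<le> a + b"
    using robust_wasserstein_le_kernel[OF r mu KL, of "a + b"] ab by simp
  then show "robust_wasserstein r \<mu> \<rho> \<le> robust_wasserstein r \<mu> \<nu> + robust_wasserstein r \<nu> \<rho> + \<delta>"
    by (simp add: a_def b_def)
qed

text \<open>
  Under a coupling, a pair whose first point lies in \<open>F\<close> either has its second point within \<open>\<delta>\<close> of \<open>F\<close> or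
  has cost at least \<open>min \<delta> (2r)\<close>. Couplings of arbitrarily small cost exist, and for these Markov's
  inequality makes the second event as unlikely as desired.
\<close>

lemma emeasure_closed_le_thickening:
  fixes \<mu> \<nu> :: "'a::{metric_space, second_countable_topology} measure"
  assumes r: "r > 0" and mu: "\<mu> \<in> borel_probs" and nu: "\<nu> \<in> borel_probs"
    and W: "robust_wasserstein r \<mu> \<nu> = 0" and F: "closed F" "F \<noteq> {}" and delta: "\<delta> > 0"
  shows "emeasure \<mu> F \<le> emeasure \<nu> {x. infdist x F < \<delta>}"
proof (rule ennreal_le_epsilon)
  fix t :: real assume "t > 0"
  define m where "m = min \<delta> (2 * r)"
  have m: "m > 0" using delta r by (simp add: m_def)
  obtain \<pi> where pi: "\<pi> \<in> couplings \<mu> \<nu>"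
    and cost: "(\<integral>\<^sup>+z. trunc_dist r (fst z) (snd z) \<partial>\<pi>) < ennreal (t * m)"
    using robust_wasserstein_less_obtains_coupling[OF r mu nu, of "t * m"] W m \<open>t > 0\<close> by auto
  have mu': "\<mu> = distr \<pi> borel fst" and nu': "\<nu> = distr \<pi> borel snd"
    using pi by (simp_all add: couplings_def)
  have [measurable]: "fst \<in> \<pi> \<rightarrow>\<^sub>M (borel :: 'a measure)" "snd \<in> \<pi> \<rightarrow>\<^sub>M (borel :: 'a measure)"
    by (simp_all add: measurable_cong_sets[OF sets_coupling[OF pi]])
  have [measurable]: "F \<in> sets borel" "{x. infdist x F < \<delta>} \<in> sets borel"
    using F by (auto intro!: borel_closed borel_open open_Collect_less continuous_on_infdist continuous_on_id continuous_on_const)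
  let ?far = "{z \<in> space \<pi>. 1 \<le> ennreal (1 / m) * trunc_dist r (fst z) (snd z)}"
  have "emeasure \<mu> F = emeasure \<pi> (fst -` F \<inter> space \<pi>)"
    unfolding mu' by (rule emeasure_distr) measurable
  also have "\<dots> \<le> emeasure \<pi> ((snd -` {x. infdist x F < \<delta>} \<inter> space \<pi>) \<union> ?far)"
  proof (rule emeasure_mono)
    show "fst -` F \<inter> space \<pi> \<subseteq> (snd -` {x. infdist x F < \<delta>} \<inter> space \<pi>) \<union> ?far"
    proof
      fix z assume z: "z \<in> fst -` F \<inter> space \<pi>"
      show "z \<in> (snd -` {x. infdist x F < \<delta>} \<inter> space \<pi>) \<union> ?far"
      proof (cases "infdist (snd z) F < \<delta>")
        case False
        have "infdist (snd z) F \<le> dist (fst z) (snd z)"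
          using z infdist_le[of "fst z" F "snd z"] by (simp add: dist_commute)
        then have "m \<le> min (dist (fst z) (snd z)) (2 * r)"
          using False by (simp add: m_def)
        then have "1 \<le> (1 / m) * min (dist (fst z) (snd z)) (2 * r)"
          using m by (simp add: field_simps)
        then have "z \<in> ?far"
          using z m by (simp add: trunc_dist_def flip: ennreal_mult'')
        then show ?thesis ..
      qed (use z in simp)
    qed
  qed measurable
  also have "\<dots> \<le> emeasure \<pi> (snd -` {x. infdist x F < \<delta>} \<inter> space \<pi>) + emeasure \<pi> ?far"
    by (rule emeasure_subadditive) measurable
  also have "emeasure \<pi> (snd -` {x. infdist x F < \<delta>} \<inter> space \<pi>) = emeasure \<nu> {x. infdist x F < \<delta>}"
    unfolding nu' by (rule emeasure_distr[symmetric]) measurable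
  also have "emeasure \<pi> ?far \<le> ennreal (1 / m) * (\<integral>\<^sup>+z. trunc_dist r (fst z) (snd z) \<partial>\<pi>)"
    using nn_integral_Markov_inequality
      [of "\<lambda>z. trunc_dist r (fst z) (snd z)" "space \<pi>" \<pi> "ennreal (1 / m)"]
    by (simp cong: nn_integral_cong)
  also have "\<dots> \<le> ennreal (1 / m) * ennreal (t * m)"
    using cost by (intro mult_left_mono) auto
  also have "\<dots> = ennreal t"
    using m \<open>t > 0\<close> by (simp flip: ennreal_mult'')
  finally show "emeasure \<mu> F \<le> emeasure \<nu> {x. infdist x F < \<delta>} + ennreal t"
    by (simp add: add_left_mono)
qed

lemma emeasure_closed_le_if_robust_wasserstein_eq_0:
  fixes \<mu> \<nu> :: "'a::{metric_space, second_countable_topology} measure"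
  assumes r: "r > 0" and mu: "\<mu> \<in> borel_probs" and nu: "\<nu> \<in> borel_probs"
    and W: "robust_wasserstein r \<mu> \<nu> = 0" and F: "closed F"
  shows "emeasure \<mu> F \<le> emeasure \<nu> F"
proof (cases "F = {}")
  case False
  interpret nu: prob_space \<nu> using nu by (simp add: borel_probs_def)
  have sets_nu: "sets \<nu> = sets borel" using nu by (simp add: borel_probs_def)
  define G where "G n = {x. infdist x F < inverse (real (Suc n))}" for n
  have "x \<in> F" if "\<And>n. x \<in> G n" for x
  proof -
    have "\<not> 0 < infdist x F"
    proof
      assume "0 < infdist x F"
      then obtain n where "inverse (real (Suc n)) < infdist x F"
        using reals_Archimedean by blast
      then show False using that[of n] by (simp add: G_def)
    qed
    then have "infdist x F = 0" using infdist_nonneg[of x F] by linarith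
    then show ?thesis using in_closed_iff_infdist_zero[OF F False] by blast
  qed
  moreover have "x \<in> G n" if "x \<in> F" for x n
    using that by (simp add: G_def)
  ultimately have INT: "(\<Inter>n. G n) = F" by auto
  have dec: "decseq G"
    by (auto simp: decseq_def G_def elim!: less_le_trans intro!: le_imp_inverse_le)
  have "range G \<subseteq> sets \<nu>"
    unfolding sets_nu G_def by (auto intro!: borel_closed borel_open open_Collect_less continuous_on_infdist continuous_on_id continuous_on_const)
  then have "(\<lambda>n. emeasure \<nu> (G n)) \<longlonglongrightarrow> emeasure \<nu> F"
    using Lim_emeasure_decseq[of G \<nu>] dec INT by simp
  moreover have "emeasure \<mu> F \<le> emeasure \<nu> (G n)" for n
    unfolding G_def by (rule emeasure_closed_le_thickening[OF r mu nu W F False]) simp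
  ultimately show ?thesis
    by (intro LIMSEQ_le_const) auto
qed simp

lemma robust_wasserstein_eq_0_imp_eq:
  fixes \<mu> \<nu> :: "'a::{metric_space, second_countable_topology} measure"
  assumes r: "r > 0" and mu: "\<mu> \<in> borel_probs" and nu: "\<nu> \<in> borel_probs"
    and W: "robust_wasserstein r \<mu> \<nu> = 0"
  shows "\<mu> = \<nu>"
proof (rule measure_eqI_generator_eq[of "Collect closed" UNIV \<mu> \<nu> "\<lambda>_. UNIV"])
  show "Int_stable (Collect closed)" by (auto simp: Int_stable_def)
  show "sets \<mu> = sigma_sets UNIV (Collect closed)" "sets \<nu> = sigma_sets UNIV (Collect closed)"
    using mu nu by (simp_all add: borel_probs_def borel_eq_closed)
  have W': "robust_wasserstein r \<nu> \<mu> = 0"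
    using robust_wasserstein_le_commute[OF r, of \<nu> \<mu>] robust_wasserstein_nonneg[OF r, of \<nu> \<mu>] W by simp
  show "emeasure \<mu> F = emeasure \<nu> F" if "F \<in> Collect closed" for F
    using emeasure_closed_le_if_robust_wasserstein_eq_0[OF r mu nu W, of F]
      emeasure_closed_le_if_robust_wasserstein_eq_0[OF r nu mu W', of F] that by auto
  show "emeasure \<mu> UNIV \<noteq> \<infinity>" for i :: nat
    by (simp add: emeasure_space_borel_prob[OF mu])
qed auto

theorem Metric_space_robust_wasserstein:
  assumes "r > 0"
  shows "Metric_space (borel_probs :: 'a::{metric_space, second_countable_topology} measure set)
    (robust_wasserstein r)"
proof
  fix \<mu> \<nu> \<rho> :: "'a measure"
  show "0 \<le> robust_wasserstein r \<mu> \<nu>"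
    by (rule robust_wasserstein_nonneg[OF assms])
  show "robust_wasserstein r \<mu> \<nu> = robust_wasserstein r \<nu> \<mu>"
    by (intro antisym robust_wasserstein_le_commute assms)
  show "(robust_wasserstein r \<mu> \<nu> = 0) = (\<mu> = \<nu>)" if "\<mu> \<in> borel_probs" "\<nu> \<in> borel_probs"
    using that robust_wasserstein_eq_0_imp_eq[OF assms that] robust_wasserstein_refl[OF assms, of \<mu>] by auto
  show "robust_wasserstein r \<mu> \<rho> \<le> robust_wasserstein r \<mu> \<nu> + robust_wasserstein r \<nu> \<rho>"
    if "\<mu> \<in> borel_probs" "\<nu> \<in> borel_probs" "\<rho> \<in> borel_probs"
    using robust_wasserstein_triangle[OF assms that] .
qed

section \<open>Markov chains with prescribed kernels\<close>

text \<open>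
  The measure comes from the theorem of Ionescu-Tulcea, with transition laws that depend only on the
  last coordinate. That the coordinate \<open>n\<close> has law \<open>\<mu> n\<close> is an induction on \<open>n\<close>; the joint law of two
  consecutive coordinates then follows from one more step of the chain.
\<close>

lemma obtain_markov_chain:
  fixes \<mu> :: "nat \<Rightarrow> 'a::topological_space measure" and K :: "nat \<Rightarrow> 'a \<Rightarrow> 'a measure"
  assumes mu: "\<And>n. \<mu> n \<in> borel_probs" and K: "\<And>n. K n \<in> borel \<rightarrow>\<^sub>M prob_algebra borel"
    and mu_K: "\<And>n. \<mu> n \<bind> K n = \<mu> (Suc n)"
  obtains \<Omega> :: "(nat \<Rightarrow> 'a) measure" where "prob_space \<Omega>"
    "\<And>n. (\<lambda>\<omega>. \<omega> n) \<in> \<Omega> \<rightarrow>\<^sub>M borel" "\<And>n. distr \<Omega> borel (\<lambda>\<omega>. \<omega> n) = \<mu> n"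
    "\<And>n f. f \<in> borel_measurable (borel \<Otimes>\<^sub>M borel) \<Longrightarrow>
       (\<integral>\<^sup>+\<omega>. f (\<omega> n, \<omega> (Suc n)) \<partial>\<Omega>) = (\<integral>\<^sup>+x. \<integral>\<^sup>+y. f (x, y) \<partial>K n x \<partial>\<mu> n)"
proof -
  let ?M = "\<lambda>_::nat. borel :: 'a measure"
  define P :: "nat \<Rightarrow> (nat \<Rightarrow> 'a) \<Rightarrow> 'a measure"
    where "P i \<omega> = (case i of 0 \<Rightarrow> \<mu> 0 | Suc n \<Rightarrow> K n (\<omega> n))" for i \<omega>
  note K' = measurable_prob_algebraD[OF K]
  have sets_mu: "sets (\<mu> n) = sets borel" for n
    using mu by (simp add: borel_probs_def)
  have sets_K: "sets (K n x) = sets borel" for n x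
    using measurable_space[OF K, of x n] by (simp add: space_prob_algebra)
  have P_0: "P 0 \<omega> = \<mu> 0" and P_Suc: "P (Suc n) \<omega> = K n (\<omega> n)" for n \<omega>
    by (simp_all add: P_def)
  have P_prob: "P i \<in> Pi\<^sub>M {0..<i} ?M \<rightarrow>\<^sub>M prob_algebra borel" for i
  proof (cases i)
    case 0
    then show ?thesis using mu[of 0] by (simp add: P_def[abs_def] borel_probs_eq_space_prob_algebra)
  next
    case (Suc n)
    have "(\<lambda>\<omega>. K n (\<omega> n)) \<in> Pi\<^sub>M {0..<i} ?M \<rightarrow>\<^sub>M prob_algebra borel"
      using Suc by (intro measurable_compose[of "\<lambda>\<omega>. \<omega> n" _ borel "K n"] K measurable_component_singleton) auto
    then show ?thesis using Suc by (simp add: P_def[abs_def])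
  qed
  interpret IT: Ionescu_Tulcea P ?M
  proof (rule Ionescu_Tulcea.intro)
    show "P i \<in> Pi\<^sub>M {0..<i} ?M \<rightarrow>\<^sub>M subprob_algebra borel" for i
      by (rule measurable_prob_algebraD[OF P_prob])
    show "prob_space (P i x)" if "x \<in> space (Pi\<^sub>M {0..<i} ?M)" for i x
      using measurable_space[OF P_prob that] by (simp add: space_prob_algebra)
  qed
  let ?C = "\<lambda>n. IT.C 0 n (\<lambda>_. undefined)" and ?\<Omega> = "IT.PF.lim"
  have u: "(\<lambda>_. undefined) \<in> space (Pi\<^sub>M {0..<0} ?M)" by simp
  have sets_C: "sets (?C n) = sets (Pi\<^sub>M {0..<n} ?M)" for n
    using IT.sets_C[OF u, of n] by simp
  have space_C: "space (?C n) = space (Pi\<^sub>M {0..<n} ?M)" for n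
    using IT.space_C[OF u, of n] by simp
  have prob_C: "prob_space (?C n)" for n
    using IT.prob_space_C[OF u, of n] .
  have distr_C: "distr ?\<Omega> (Pi\<^sub>M {0..<n} ?M) (\<lambda>\<omega>. restrict \<omega> {0..<n}) = ?C n" for n
  proof -
    have sets_CI: "sets (IT.CI {0..<n}) = sets (Pi\<^sub>M {0..<n} ?M)"
      by (simp add: IT.CI_def)
    have "IT.CI {0..<n} = ?C n"
    proof (rule measure_eqI)
      fix A assume "A \<in> sets (IT.CI {0..<n})"
      then have A: "A \<in> sets (Pi\<^sub>M {0..<n} ?M)" by (simp add: sets_CI)
      then have "A \<subseteq> (\<Pi>\<^sub>E i\<in>{0..<n}. space (?M i))"
        using sets.sets_into_space[OF A] by (simp add: space_PiM)
      then show "emeasure (IT.CI {0..<n}) A = emeasure (?C n) A"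
        using IT.emeasure_CI[of "{0..<n}" n A] A by (simp add: prod_emb_id)
    qed (simp add: sets_CI sets_C)
    then show ?thesis
      using IT.distr_lim[of "{0..<n}"] by simp
  qed
  have nn_C: "(\<integral>\<^sup>+\<omega>. f (restrict \<omega> {0..<n}) \<partial>?\<Omega>) = (\<integral>\<^sup>+\<omega>. f \<omega> \<partial>?C n)"
    if f: "f \<in> borel_measurable (Pi\<^sub>M {0..<n} ?M)" for n f
    unfolding distr_C[symmetric]
    using f by (subst nn_integral_distr) (auto simp: measurable_cong_sets[OF IT.PF.sets_lim refl] intro!: measurable_restrict measurable_component_singleton)
  have nn_C_Suc: "(\<integral>\<^sup>+\<omega>. f \<omega> \<partial>?C (Suc n)) = (\<integral>\<^sup>+\<omega>. \<integral>\<^sup>+y. f (fun_upd \<omega> n y) \<partial>P n \<omega> \<partial>?C n)"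
    if f: "f \<in> borel_measurable (Pi\<^sub>M {0..<Suc n} ?M)" for n f
  proof -
    have "IT.eP n \<in> ?C n \<rightarrow>\<^sub>M subprob_algebra (Pi\<^sub>M {0..<Suc n} ?M)"
      using IT.measurable_eP[of n] by (simp add: measurable_cong_sets[OF sets_C refl])
    then have "(\<integral>\<^sup>+\<omega>. f \<omega> \<partial>?C (Suc n)) = (\<integral>\<^sup>+\<omega>. \<integral>\<^sup>+\<omega>'. f \<omega>' \<partial>IT.eP n \<omega> \<partial>?C n)"
      using f by (simp add: nn_integral_bind)
    also have "\<dots> = (\<integral>\<^sup>+\<omega>. \<integral>\<^sup>+y. f (fun_upd \<omega> n y) \<partial>P n \<omega> \<partial>?C n)"
      using f by (intro nn_integral_cong IT.nn_integral_eP) (auto simp: space_C)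
    finally show ?thesis .
  qed
  have step: "(\<integral>\<^sup>+\<omega>. g (\<omega> n) \<partial>?C (Suc n)) = (\<integral>\<^sup>+x. g x \<partial>\<mu> n)"
    if g: "g \<in> borel_measurable borel" for g n
    using g
  proof (induction n arbitrary: g)
    case 0
    then have "(\<lambda>\<omega>. g (\<omega> 0)) \<in> borel_measurable (Pi\<^sub>M {0..<Suc 0} ?M)"
      by (intro measurable_compose[OF measurable_component_singleton]) auto
    from nn_C_Suc[OF this] show ?case
      using prob_space.emeasure_space_1[OF prob_C[of 0]] by (simp add: P_0 del: IT.C.simps)
  next
    case (Suc n)
    have "(\<lambda>\<omega>. g (\<omega> (Suc n))) \<in> borel_measurable (Pi\<^sub>M {0..<Suc (Suc n)} ?M)"
      using Suc.prems by (intro measurable_compose[OF measurable_component_singleton]) auto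
    from nn_C_Suc[OF this]
    have "(\<integral>\<^sup>+\<omega>. g (\<omega> (Suc n)) \<partial>?C (Suc (Suc n))) = (\<integral>\<^sup>+\<omega>. \<integral>\<^sup>+y. g y \<partial>K n (\<omega> n) \<partial>?C (Suc n))"
      by (simp add: P_Suc del: IT.C.simps)
    also have "\<dots> = (\<integral>\<^sup>+x. \<integral>\<^sup>+y. g y \<partial>K n x \<partial>\<mu> n)"
    proof (rule Suc.IH)
      show "(\<lambda>x. integral\<^sup>N (K n x) g) \<in> borel_measurable borel"
        by (rule measurable_compose[OF K' nn_integral_measurable_subprob_algebra]) (rule Suc.prems)
    qed
    also have "\<dots> = (\<integral>\<^sup>+y. g y \<partial>(\<mu> n \<bind> K n))"
      using K'[of n] Suc.prems by (intro nn_integral_bind[symmetric]) (auto simp: measurable_cong_sets[OF sets_mu refl])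
    finally show ?case by (simp add: mu_K)
  qed
  have component: "(\<lambda>\<omega>. \<omega> n) \<in> ?\<Omega> \<rightarrow>\<^sub>M borel" for n
    by (simp add: measurable_cong_sets[OF IT.PF.sets_lim refl])
  have nn_component: "(\<integral>\<^sup>+\<omega>. g (\<omega> n) \<partial>?\<Omega>) = (\<integral>\<^sup>+x. g x \<partial>\<mu> n)"
    if g: "g \<in> borel_measurable borel" for g n
  proof -
    have "(\<lambda>\<omega>. g (\<omega> n)) \<in> borel_measurable (Pi\<^sub>M {0..<Suc n} ?M)"
      using g by (intro measurable_compose[OF measurable_component_singleton]) auto
    from nn_C[OF this] show ?thesis by (simp add: step[OF g] del: IT.C.simps)
  qed
  show thesis
  proof (rule that[of ?\<Omega>])
    show "prob_space ?\<Omega>"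
    proof (rule prob_spaceI)
      show "emeasure ?\<Omega> (space ?\<Omega>) = 1"
        using nn_component[of "\<lambda>_. 1" 0] emeasure_space_borel_prob[OF mu[of 0]] sets_eq_imp_space_eq[OF sets_mu[of 0]]
        by simp
    qed
    show "(\<lambda>\<omega>. \<omega> n) \<in> ?\<Omega> \<rightarrow>\<^sub>M borel" for n by (rule component)
    show "distr ?\<Omega> borel (\<lambda>\<omega>. \<omega> n) = \<mu> n" for n
    proof (rule measure_eqI)
      fix A assume "A \<in> sets (distr ?\<Omega> borel (\<lambda>\<omega>. \<omega> n))"
      then have A: "A \<in> sets borel" by simp
      have "emeasure (distr ?\<Omega> borel (\<lambda>\<omega>. \<omega> n)) A = (\<integral>\<^sup>+x. indicator A x \<partial>distr ?\<Omega> borel (\<lambda>\<omega>. \<omega> n))"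
        using A by simp
      also have "\<dots> = (\<integral>\<^sup>+\<omega>. indicator A (\<omega> n) \<partial>?\<Omega>)"
        using A by (intro nn_integral_distr component) auto
      also have "\<dots> = (\<integral>\<^sup>+x. indicator A x \<partial>\<mu> n)"
        using A by (intro nn_component) auto
      finally show "emeasure (distr ?\<Omega> borel (\<lambda>\<omega>. \<omega> n)) A = emeasure (\<mu> n) A"
        using A by (simp add: sets_mu)
    qed (simp add: sets_mu)
    show "(\<integral>\<^sup>+\<omega>. f (\<omega> n, \<omega> (Suc n)) \<partial>?\<Omega>) = (\<integral>\<^sup>+x. \<integral>\<^sup>+y. f (x, y) \<partial>K n x \<partial>\<mu> n)"
      if f: "f \<in> borel_measurable (borel \<Otimes>\<^sub>M borel)" for n f
    proof -
      have "(\<lambda>\<omega>. f (\<omega> n, \<omega> (Suc n))) \<in> borel_measurable (Pi\<^sub>M {0..<Suc (Suc n)} ?M)"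
        by (intro measurable_compose[OF _ f] measurable_Pair measurable_component_singleton) auto
      from nn_C[OF this] nn_C_Suc[OF this]
      have "(\<integral>\<^sup>+\<omega>. f (\<omega> n, \<omega> (Suc n)) \<partial>?\<Omega>) = (\<integral>\<^sup>+\<omega>. \<integral>\<^sup>+y. f (\<omega> n, y) \<partial>K n (\<omega> n) \<partial>?C (Suc n))"
        by (simp add: P_Suc del: IT.C.simps)
      also have "\<dots> = (\<integral>\<^sup>+x. \<integral>\<^sup>+y. f (x, y) \<partial>K n x \<partial>\<mu> n)"
      proof (rule step)
        show "(\<lambda>x. \<integral>\<^sup>+y. f (x, y) \<partial>K n x) \<in> borel_measurable borel"
          by (rule nn_integral_measurable_subprob_algebra2[OF _ K']) (simp add: f)
      qed
      finally show ?thesis .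
    qed
  qed
qed

section \<open>Completeness\<close>

text \<open>
  The terms of a convergent series are eventually below \<open>2r\<close>, and there the truncation does nothing.
\<close>

lemma Cauchy_if_trunc_dist_summable:
  fixes x :: "nat \<Rightarrow> 'a::metric_space"
  assumes r: "r > 0" and fin: "(\<Sum>n. trunc_dist r (x n) (x (Suc n))) < \<infinity>"
  shows "Cauchy x"
proof -
  let ?c = "\<lambda>n. min (dist (x n) (x (Suc n))) (2 * r)"
  have "summable ?c"
    using fin r by (intro summable_suminf_not_top) (auto simp: trunc_dist_def)
  then have "?c \<longlonglongrightarrow> 0"
    by (rule summable_LIMSEQ_zero)
  then have ev: "\<forall>\<^sub>F n in sequentially. ?c n < 2 * r"
    using r by (intro order_tendstoD(2)) auto
  have "\<forall>\<^sub>F n in sequentially. norm (dist (x n) (x (Suc n))) \<le> ?c n"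
    using ev by eventually_elim auto
  then have d: "summable (\<lambda>n. dist (x n) (x (Suc n)))"
    by (rule summable_comparison_test_ev) fact
  show ?thesis
  proof (rule metric_CauchyI)
    fix e :: real assume "e > 0"
    obtain N where N: "\<And>m n. m \<ge> N \<Longrightarrow> norm (\<Sum>k=m..<n. dist (x k) (x (Suc k))) < e"
      using d \<open>e > 0\<close> unfolding summable_Cauchy by blast
    have chain: "dist (x m) (x n) \<le> (\<Sum>k=m..<n. dist (x k) (x (Suc k)))" if "m \<le> n" for m n
      using that
    proof (induction n rule: dec_induct)
      case (step n)
      then show ?case using dist_triangle[of "x m" "x (Suc n)" "x n"] by simp
    qed simp
    have le: "dist (x m) (x n) < e" if "m \<le> n" "N \<le> m" for m n
      using chain[OF that(1)] N[OF that(2), of n] by simp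
    show "\<exists>M. \<forall>m\<ge>M. \<forall>n\<ge>M. dist (x m) (x n) < e"
      using le by (metis dist_commute nle_le)
  qed
qed

lemma trunc_dist_limit_le:
  fixes x :: "nat \<Rightarrow> 'a::metric_space"
  assumes r: "r > 0" and lim: "x \<longlonglongrightarrow> y"
  shows "trunc_dist r (x n) y \<le> (\<Sum>k. trunc_dist r (x (n + k)) (x (Suc (n + k))))"
proof (rule LIMSEQ_le_const2)
  show "(\<lambda>m. trunc_dist r (x n) (x (n + m))) \<longlonglongrightarrow> trunc_dist r (x n) y"
    unfolding trunc_dist_def
    by (intro tendsto_ennrealI tendsto_min tendsto_dist tendsto_const LIMSEQ_ignore_initial_segment[OF lim, of n, unfolded add.commute[of _ n]])
  have "trunc_dist r (x n) (x (n + m)) \<le> (\<Sum>k<m. trunc_dist r (x (n + k)) (x (Suc (n + k))))" for m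
  proof (induction m)
    case 0
    then show ?case using r by (simp add: trunc_dist_def)
  next
    case (Suc m)
    have "trunc_dist r (x n) (x (n + Suc m)) \<le> trunc_dist r (x n) (x (n + m)) + trunc_dist r (x (n + m)) (x (Suc (n + m)))"
      using trunc_dist_triangle[OF r] by simp
    also have "\<dots> \<le> (\<Sum>k<m. trunc_dist r (x (n + k)) (x (Suc (n + k)))) + trunc_dist r (x (n + m)) (x (Suc (n + m)))"
      by (rule add_right_mono[OF Suc.IH])
    finally show ?case by simp
  qed
  moreover have "(\<Sum>k<m. trunc_dist r (x (n + k)) (x (Suc (n + k)))) \<le> (\<Sum>k. trunc_dist r (x (n + k)) (x (Suc (n + k))))" for m
    by (intro sum_le_suminf) auto
  ultimately show "\<exists>N. \<forall>m\<ge>N. trunc_dist r (x n) (x (n + m)) \<le> (\<Sum>k. trunc_dist r (x (n + k)) (x (Suc (n + k))))"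
    by (meson order_trans)
qed

text \<open>
  Let \<open>X\<close> be the Markov chain built from nearly optimal kernels, and \<open>\<nu>\<close> the law of its pathwise limit
  \<open>Z\<close>. The pair \<open>(X n, Z)\<close> is a coupling of \<open>\<mu> n\<close> and \<open>\<nu>\<close>, whose cost is at most the expected cost of all
  steps from time \<open>n\<close> on, hence at most the tail \<open>2 * (1/2)\<^sup>n\<close> of the geometric series.
\<close>

lemma robust_wasserstein_limit_exists:
  fixes \<mu> :: "nat \<Rightarrow> 'a::polish_space measure"
  assumes r: "r > 0" and mu: "\<And>n. \<mu> n \<in> borel_probs"
    and W: "\<And>n. robust_wasserstein r (\<mu> n) (\<mu> (Suc n)) < (1/2) ^ n"
  obtains \<nu> where "\<nu> \<in> borel_probs" "\<And>n. robust_wasserstein r (\<mu> n) \<nu> \<le> 2 * (1/2) ^ n"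
proof -
  have "\<exists>K. K \<in> borel \<rightarrow>\<^sub>M prob_algebra borel \<and> \<mu> n \<bind> K = \<mu> (Suc n) \<and>
      (\<integral>\<^sup>+x. \<integral>\<^sup>+y. trunc_dist r x y \<partial>K x \<partial>\<mu> n) \<le> ennreal ((1/2) ^ n)" for n
    by (rule robust_wasserstein_less_obtains_kernel[OF r mu mu W]) blast
  then obtain K where K: "\<And>n. K n \<in> borel \<rightarrow>\<^sub>M prob_algebra borel" "\<And>n. \<mu> n \<bind> K n = \<mu> (Suc n)"
      "\<And>n. (\<integral>\<^sup>+x. \<integral>\<^sup>+y. trunc_dist r x y \<partial>K n x \<partial>\<mu> n) \<le> ennreal ((1/2) ^ n)"
    by metis
  obtain \<Omega> where prob: "prob_space \<Omega>" and X [measurable]: "\<And>n. (\<lambda>\<omega>. \<omega> n) \<in> \<Omega> \<rightarrow>\<^sub>M borel"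
    and law: "\<And>n. distr \<Omega> borel (\<lambda>\<omega>. \<omega> n) = \<mu> n"
    and pair: "\<And>n f. f \<in> borel_measurable (borel \<Otimes>\<^sub>M borel) \<Longrightarrow>
       (\<integral>\<^sup>+\<omega>. f (\<omega> n, \<omega> (Suc n)) \<partial>\<Omega>) = (\<integral>\<^sup>+x. \<integral>\<^sup>+y. f (x, y) \<partial>K n x \<partial>\<mu> n)"
    by (rule obtain_markov_chain[of \<mu> K, OF mu K(1,2)]) blast
  interpret prob_space \<Omega> by (rule prob)
  let ?d = "\<lambda>k \<omega>. trunc_dist r (\<omega> k) (\<omega> (Suc k))"
  have step: "(\<integral>\<^sup>+\<omega>. ?d k \<omega> \<partial>\<Omega>) \<le> ennreal ((1/2) ^ k)" for k
    using pair[of "\<lambda>z. trunc_dist r (fst z) (snd z)" k] K(3)[of k] by simp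
  have tail: "(\<integral>\<^sup>+\<omega>. (\<Sum>k. ?d (n + k) \<omega>) \<partial>\<Omega>) \<le> ennreal (2 * (1/2) ^ n)" for n
  proof -
    have "(\<integral>\<^sup>+\<omega>. (\<Sum>k. ?d (n + k) \<omega>) \<partial>\<Omega>) = (\<Sum>k. \<integral>\<^sup>+\<omega>. ?d (n + k) \<omega> \<partial>\<Omega>)"
      by (rule nn_integral_suminf) measurable
    also have "\<dots> \<le> (\<Sum>k. ennreal ((1/2) ^ (n + k)))"
      by (intro suminf_le step) auto
    also have "\<dots> = ennreal (\<Sum>k. (1/2) ^ (n + k))"
      by (rule suminf_ennreal2) (auto simp: power_add intro!: summable_mult summable_geometric)
    also have "(\<Sum>k. (1/2) ^ (n + k)) = (2 * (1/2) ^ n :: real)"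
      by (simp add: power_add suminf_mult suminf_geometric summable_geometric)
    finally show ?thesis .
  qed
  define G where "G = {\<omega> \<in> space \<Omega>. (\<Sum>k. ?d k \<omega>) < \<infinity>}"
  have [measurable]: "G \<in> sets \<Omega>"
    unfolding G_def by measurable
  have "AE \<omega> in \<Omega>. (\<Sum>k. ?d k \<omega>) \<noteq> \<infinity>"
    using tail[of 0] by (intro nn_integral_noteq_infinite) (auto simp: top_unique)
  then have AE_G: "AE \<omega> in \<Omega>. \<omega> \<in> G"
    by (auto simp: G_def less_top elim!: AE_mp)
  \<comment> \<open>\<open>Y\<close> agrees with the chain almost surely and converges on every path, which makes \<open>Z\<close> measurable.\<close>
  define Y where "Y n \<omega> = (if \<omega> \<in> G then \<omega> n else undefined)" for n and \<omega> :: "nat \<Rightarrow> 'a"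
  define Z where "Z \<omega> = lim (\<lambda>n. Y n \<omega>)" for \<omega>
  have Y_lim: "(\<lambda>n. Y n \<omega>) \<longlonglongrightarrow> Z \<omega>" for \<omega>
  proof -
    have "Cauchy (\<lambda>n. Y n \<omega>)"
    proof (cases "\<omega> \<in> G")
      case True
      then show ?thesis
        using Cauchy_if_trunc_dist_summable[OF r, of \<omega>] by (simp add: Y_def G_def)
    next
      case False
      then show ?thesis
        by (simp add: Y_def convergent_Cauchy convergent_const)
    qed
    then show ?thesis
      unfolding Z_def by (simp add: Cauchy_convergent_iff convergent_LIMSEQ_iff)
  qed
  have [measurable]: "Y n \<in> \<Omega> \<rightarrow>\<^sub>M borel" for n
    unfolding Y_def by measurable
  have Z [measurable]: "Z \<in> \<Omega> \<rightarrow>\<^sub>M borel"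
    by (rule borel_measurable_LIMSEQ_metric[OF _ Y_lim]) measurable
  define \<nu> where "\<nu> = distr \<Omega> borel Z"
  have nu: "\<nu> \<in> borel_probs"
    using prob_space_distr[OF Z] by (simp add: borel_probs_def \<nu>_def)
  moreover have "robust_wasserstein r (\<mu> n) \<nu> \<le> 2 * (1/2) ^ n" for n
  proof -
    have XZ [measurable]: "(\<lambda>\<omega>. (\<omega> n, Z \<omega>)) \<in> \<Omega> \<rightarrow>\<^sub>M (borel :: ('a \<times> 'a) measure)"
      unfolding borel_prod[symmetric] by measurable
    have proj [measurable]: "(fst :: 'a \<times> 'a \<Rightarrow> 'a) \<in> borel \<rightarrow>\<^sub>M borel"
        "(snd :: 'a \<times> 'a \<Rightarrow> 'a) \<in> borel \<rightarrow>\<^sub>M borel"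
      unfolding borel_prod[symmetric] by measurable
    let ?\<pi> = "distr \<Omega> borel (\<lambda>\<omega>. (\<omega> n, Z \<omega>))"
    have "?\<pi> \<in> couplings (\<mu> n) \<nu>"
      using prob_space_distr[OF XZ] by (simp add: couplings_def borel_probs_def distr_distr o_def \<nu>_def law)
    moreover have "(\<integral>\<^sup>+z. trunc_dist r (fst z) (snd z) \<partial>?\<pi>) \<le> ennreal (2 * (1/2) ^ n)"
    proof -
      have "(\<integral>\<^sup>+z. trunc_dist r (fst z) (snd z) \<partial>?\<pi>) = (\<integral>\<^sup>+\<omega>. trunc_dist r (\<omega> n) (Z \<omega>) \<partial>\<Omega>)"
        by (subst nn_integral_distr) simp_all
      also have "\<dots> \<le> (\<integral>\<^sup>+\<omega>. (\<Sum>k. ?d (n + k) \<omega>) \<partial>\<Omega>)"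
      proof (rule nn_integral_mono_AE)
        show "AE \<omega> in \<Omega>. trunc_dist r (\<omega> n) (Z \<omega>) \<le> (\<Sum>k. ?d (n + k) \<omega>)"
          using AE_G
        proof eventually_elim
          case (elim \<omega>)
          then have "\<omega> \<longlonglongrightarrow> Z \<omega>" using Y_lim[of \<omega>] by (simp add: Y_def)
          then show ?case by (rule trunc_dist_limit_le[OF r])
        qed
      qed
      finally show ?thesis using tail[of n] by simp
    qed
    ultimately show ?thesis
      by (intro robust_wasserstein_le[OF r mu nu]) auto
  qed
  ultimately show thesis using that by blast
qed

theorem mcomplete_robust_wasserstein:
  assumes r: "r > 0"
  shows "Metric_space.mcomplete (borel_probs :: 'a::polish_space measure set) (robust_wasserstein r)"
proof -
  interpret W: Metric_space "borel_probs :: 'a measure set" "robust_wasserstein r"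
    by (rule Metric_space_robust_wasserstein[OF r])
  show ?thesis
    unfolding W.mcomplete_def
  proof safe
    fix \<sigma> :: "nat \<Rightarrow> 'a measure" assume cauchy: "W.MCauchy \<sigma>"
    then have in_P: "\<sigma> n \<in> borel_probs" for n
      by (auto simp: W.MCauchy_def)
    have "\<exists>N. \<forall>m k. N \<le> m \<longrightarrow> N \<le> k \<longrightarrow> robust_wasserstein r (\<sigma> m) (\<sigma> k) < (1/2) ^ n" for n
      using cauchy by (simp add: W.MCauchy_def)
    then obtain N where N: "\<And>n m k. N n \<le> m \<Longrightarrow> N n \<le> k \<Longrightarrow> robust_wasserstein r (\<sigma> m) (\<sigma> k) < (1/2) ^ n"
      by metis
    \<comment> \<open>The sum keeps \<open>s n\<close> above \<open>N n\<close>, and the summand \<open>n\<close> makes \<open>s\<close> strictly monotone.\<close>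
    define s where "s n = n + (\<Sum>i\<le>n. N i)" for n
    have N_s: "N n \<le> s n" for n
      unfolding s_def by (intro trans_le_add2 member_le_sum) auto
    have s: "strict_mono s"
      by (rule strict_monoI_Suc) (simp add: s_def)
    have fast: "robust_wasserstein r (\<sigma> (s n)) (\<sigma> (s (Suc n))) < (1/2) ^ n" for n
      using N_s[of n] strict_monoD[OF s, of n "Suc n"] by (intro N) auto
    obtain \<nu> where nu: "\<nu> \<in> borel_probs" and le: "\<And>n. robust_wasserstein r (\<sigma> (s n)) \<nu> \<le> 2 * (1/2) ^ n"
      using robust_wasserstein_limit_exists[OF r, of "\<lambda>n. \<sigma> (s n)"] in_P fast by blast
    have "(\<lambda>n. 2 * (1/2) ^ n :: real) \<longlonglongrightarrow> 0"
      by (intro tendsto_mult_right_zero LIMSEQ_power_zero) simp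
    then have "limitin W.mtopology (\<sigma> \<circ> s) \<nu> sequentially"
      unfolding W.limit_metric_sequentially
      using nu in_P le by (auto simp: LIMSEQ_def) (meson le_less_trans abs_less_iff)
    then show "\<exists>\<nu>. limitin W.mtopology \<sigma> \<nu> sequentially"
      using W.MCauchy_convergent_subsequence[OF cauchy s] by blast
  qed
qed

section \<open>Density of finitely supported measures with rational weights\<close>

definition round_down :: "nat \<Rightarrow> real \<Rightarrow> real" where
  "round_down m p = real_of_int \<lfloor>real m * p\<rfloor> / real m"

lemma round_down_bounds:
  assumes "m > 0" "0 \<le> p"
  shows "round_down m p \<in> \<rat>" "0 \<le> round_down m p" "round_down m p \<le> p" "p - 1 / real m \<le> round_down m p"
proof -
  show "round_down m p \<in> \<rat>" by (simp add: round_down_def)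
  show "0 \<le> round_down m p" using assms by (simp add: round_down_def)
  have "real_of_int \<lfloor>real m * p\<rfloor> \<le> real m * p" by simp
  then show "round_down m p \<le> p" using assms by (simp add: round_down_def field_simps)
  have "real m * p - 1 \<le> real_of_int \<lfloor>real m * p\<rfloor>" by linarith
  then have "(real m * p - 1) / real m \<le> round_down m p"
    unfolding round_down_def by (rule divide_right_mono) simp
  then show "p - 1 / real m \<le> round_down m p" using assms by (simp add: diff_divide_distrib)
qed

definition two_point :: "real \<Rightarrow> 'a::topological_space \<Rightarrow> 'a \<Rightarrow> 'a measure" where
  "two_point t y a = distr (measure_pmf (bernoulli_pmf t)) borel (\<lambda>b. if b then y else a)"

lemma two_point_in_borel_probs: "two_point t y a \<in> borel_probs"
  by (auto simp: two_point_def borel_probs_def intro!: measure_pmf.prob_space_distr)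

lemma nn_integral_two_point:
  assumes "0 \<le> t" "t \<le> 1" "f \<in> borel_measurable borel"
  shows "(\<integral>\<^sup>+y. f y \<partial>two_point t x a) = ennreal t * f x + ennreal (1 - t) * f a"
  using assms by (simp add: two_point_def nn_integral_distr ac_simps)

lemma measure_two_point:
  assumes "0 \<le> t" "t \<le> 1" and A: "A \<in> sets borel"
  shows "measure (two_point t x a) A = t * indicator A x + (1 - t) * indicator A a"
proof -
  have "emeasure (two_point t x a) A = (\<integral>\<^sup>+y. indicator A y \<partial>two_point t x a)"
    using A by (simp add: two_point_def)
  also have "\<dots> = ennreal (t * indicator A x + (1 - t) * indicator A a)"
    using assms by (subst nn_integral_two_point) (auto simp: ennreal_plus[symmetric] split: split_indicator simp del: ennreal_plus)
  finally show ?thesis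
    using assms by (intro measure_eq_emeasure_eq_ennreal) auto
qed

text \<open>
  Let \<open>p i\<close> be the mass of the cell \<open>i\<close>. All but \<open>\<epsilon>\<close> of the mass lies in the first \<open>N\<close> cells. Rounding their
  masses down to multiples \<open>q i\<close> of \<open>1 / m\<close>, with \<open>m\<close> at least \<open>N / \<epsilon>\<close>, loses another \<open>\<epsilon>\<close> at most. A point of
  the cell \<open>i < N\<close> moves to \<open>e i\<close> with probability \<open>q i / p i\<close>, which costs less than \<open>\<epsilon>\<close>; with the remaining
  probability, and always from the other cells, it moves to \<open>e 0\<close>, which costs at most \<open>2r\<close> and happens
  with total probability at most \<open>2\<epsilon>\<close>. Under the image of \<open>\<mu>\<close>, the weight \<open>q i\<close> goes to \<open>e i\<close>, and \<open>e 0\<close>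
  also receives what is left.
\<close>

lemma exists_rational_finite_close:
  fixes \<mu> :: "'a::{metric_space, second_countable_topology} measure" and e :: "nat \<Rightarrow> 'a"
  assumes r: "r > 0" and mu: "\<mu> \<in> borel_probs" and eps: "\<epsilon> > 0"
    and e: "\<And>x. \<exists>n. dist x (e n) < \<epsilon>"
  obtains \<nu> N b where "\<nu> \<in> borel_probs" "robust_wasserstein r \<mu> \<nu> \<le> \<epsilon> + 4 * r * \<epsilon>"
    "\<And>i. i < N \<Longrightarrow> b i \<in> \<rat> \<inter> {0..1}" "(\<Sum>i<N. b i) = 1"
    "\<And>A. A \<in> sets borel \<Longrightarrow> measure \<nu> A = (\<Sum>i<N. b i * indicator A (e i))"
proof -
  interpret mu: prob_space \<mu> using mu by (simp add: borel_probs_def)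
  have sets_mu [measurable_cong]: "sets \<mu> = sets borel" using mu by (simp add: borel_probs_def)
  have space_mu: "space \<mu> = UNIV" using sets_eq_imp_space_eq[OF sets_mu] by simp
  define T where "T = first_within e \<epsilon>"
  have T [measurable]: "T \<in> borel \<rightarrow>\<^sub>M count_space UNIV"
    unfolding T_def by (rule measurable_first_within)
  have near: "dist x (e (T x)) < \<epsilon>" for x
    unfolding T_def by (rule dist_first_within[OF e])
  define p where "p i = measure \<mu> {x. T x = i}" for i
  have cell [measurable]: "{x. T x = i} \<in> sets \<mu>" for i
  proof -
    have "{x \<in> space borel. T x = i} \<in> sets borel" by measurable
    then show ?thesis by (simp add: sets_mu)
  qed
  have p_nonneg: "0 \<le> p i" for i
    by (simp add: p_def)
  have "(\<lambda>i. p i) sums measure \<mu> (\<Union>i. {x. T x = i})"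
    unfolding p_def by (rule mu.finite_measure_UNION) (auto simp: disjoint_family_on_def cell)
  then have "p sums 1"
    using mu.prob_space by (simp add: space_mu UNION_eq)
  then have "(\<lambda>N. \<Sum>i<N. p i) \<longlonglongrightarrow> 1"
    by (simp add: sums_def)
  then have "\<forall>\<^sub>F N in sequentially. 1 - \<epsilon> < (\<Sum>i<N. p i)"
    using eps by (intro order_tendstoD(1)) auto
  then have "\<forall>\<^sub>F N in sequentially. 0 < N \<and> 1 - \<epsilon> < (\<Sum>i<N. p i)"
    using eventually_gt_at_top[of 0] by eventually_elim auto
  then obtain N where N: "0 < N" "1 - \<epsilon> < (\<Sum>i<N. p i)"
    using eventually_happens'[OF sequentially_bot] by blast
  obtain m :: nat where m: "real N / \<epsilon> < real m"
    using reals_Archimedean2 by blast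
  have "0 < real N / \<epsilon>" using N eps by simp
  then have m_pos: "m > 0" using m by (metis gr0I less_trans of_nat_0 less_irrefl)
  have Nm: "real N / real m \<le> \<epsilon>" using m eps m_pos by (simp add: field_simps)
  define q where "q i = round_down m (p i)" for i
  note q = round_down_bounds[OF m_pos p_nonneg, folded q_def]
  define s where "s = (\<Sum>i<N. q i)"
  have s_ge: "1 - 2 * \<epsilon> \<le> s"
  proof -
    have "(\<Sum>i<N. p i) - real N / real m = (\<Sum>i<N. p i - 1 / real m)"
      by (simp add: sum_subtractf)
    also have "\<dots> \<le> s" unfolding s_def by (intro sum_mono q)
    finally show ?thesis using N Nm by linarith
  qed
  have s_le: "s \<le> 1"
  proof -
    have "s \<le> (\<Sum>i<N. p i)" unfolding s_def by (intro sum_mono q)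
    also have "\<dots> \<le> 1"
      using sum_le_suminf[of p "{..<N}"] \<open>p sums 1\<close> p_nonneg by (auto simp: sums_iff)
    finally show ?thesis .
  qed
  \<comment> \<open>If \<open>p i = 0\<close> then \<open>q i = 0\<close>, and the value \<open>0 / 0 = 0\<close> is harmless.\<close>
  define t where "t i = (if i < N then q i / p i else 0)" for i
  have t: "0 \<le> t i" "t i \<le> 1" for i
    using q[of i] p_nonneg[of i] by (auto simp: t_def divide_le_eq)
  have tp: "t i * p i = (if i < N then q i else 0)" for i
    using q[of i] by (auto simp: t_def)
  define K where "K x = two_point (t (T x)) (e (T x)) (e 0)" for x
  have K: "K \<in> borel \<rightarrow>\<^sub>M prob_algebra borel"
  proof -
    have "(\<lambda>i. two_point (t i) (e i) (e 0)) \<in> count_space UNIV \<rightarrow>\<^sub>M prob_algebra (borel :: 'a measure)"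
      using two_point_in_borel_probs by (auto simp: borel_probs_eq_space_prob_algebra)
    from measurable_compose[OF T this] show ?thesis
      by (simp add: K_def[abs_def])
  qed
  have K': "K \<in> \<mu> \<rightarrow>\<^sub>M subprob_algebra borel"
    using measurable_prob_algebraD[OF K] by (simp add: measurable_cong_sets[OF sets_mu refl])
  have integral_t: "(\<integral>x. t (T x) * f (T x) \<partial>\<mu>) = (\<Sum>i<N. q i * f i)" for f :: "nat \<Rightarrow> real"
  proof -
    have "t (T x) * f (T x) = (\<Sum>i<N. t i * f i * indicator {x. T x = i} x)" for x
    proof -
      have "(\<Sum>i<N. t i * f i * indicator {x. T x = i} x) = (\<Sum>i<N. if i = T x then t i * f i else 0)"
        by (intro sum.cong) auto
      then show ?thesis by (simp add: t_def)
    qed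
    then have "(\<integral>x. t (T x) * f (T x) \<partial>\<mu>) = (\<integral>x. (\<Sum>i<N. t i * f i * indicator {x. T x = i} x) \<partial>\<mu>)"
      by (simp only:)
    also have "\<dots> = (\<Sum>i<N. \<integral>x. t i * f i * indicator {x. T x = i} x \<partial>\<mu>)"
      by (intro Bochner_Integration.integral_sum integrable_mult_right integrable_real_indicator cell)
         (simp add: less_top[symmetric])
    also have "\<dots> = (\<Sum>i<N. t i * f i * p i)"
      by (simp add: p_def space_mu)
    also have "\<dots> = (\<Sum>i<N. q i * f i)"
    proof (rule sum.cong)
      fix i assume "i \<in> {..<N}"
      then show "t i * f i * p i = q i * f i"
        using tp[of i] by (metis lessThan_iff mult.assoc mult.commute)
    qed simp
    finally show ?thesis .
  qed
  have T_mu [measurable]: "T \<in> \<mu> \<rightarrow>\<^sub>M count_space UNIV"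
    using T by (simp add: measurable_cong_sets[OF sets_mu refl])
  have integrable_T: "integrable \<mu> (\<lambda>x. f (T x))" if "\<And>i. \<bar>f i\<bar> \<le> 1" for f :: "nat \<Rightarrow> real"
    using that by (intro mu.integrable_const_bound[of _ 1] measurable_compose[OF T_mu]) auto
  define \<nu> where "\<nu> = \<mu> \<bind> K"
  have nu: "\<nu> \<in> borel_probs"
    unfolding \<nu>_def by (rule bind_in_borel_probs[OF mu K])
  have "(\<integral>\<^sup>+x. \<integral>\<^sup>+y. trunc_dist r x y \<partial>K x \<partial>\<mu>) \<le> ennreal (\<epsilon> + 4 * r * \<epsilon>)"
  proof -
    have "(\<integral>\<^sup>+y. trunc_dist r x y \<partial>K x) \<le> ennreal (\<epsilon> + 2 * r * (1 - t (T x)))" for x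
    proof -
      let ?c = "\<lambda>y. min (dist x y) (2 * r)"
      have c: "0 \<le> ?c y" "?c y \<le> 2 * r" for y using r by auto
      have c_near: "?c (e (T x)) \<le> \<epsilon>" using near[of x] by simp
      have "(\<integral>\<^sup>+y. trunc_dist r x y \<partial>K x) = ennreal (t (T x) * ?c (e (T x)) + (1 - t (T x)) * ?c (e 0))"
        unfolding K_def using t[of "T x"] c
        by (subst nn_integral_two_point) (simp_all add: trunc_dist_def ennreal_mult ennreal_plus)
      also have "\<dots> \<le> ennreal (\<epsilon> + 2 * r * (1 - t (T x)))"
      proof (rule ennreal_leI)
        have "t (T x) * ?c (e (T x)) \<le> 1 * \<epsilon>"
          using t[of "T x"] c c_near by (intro mult_mono) auto
        moreover have "(1 - t (T x)) * ?c (e 0) \<le> (1 - t (T x)) * (2 * r)"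
          using t[of "T x"] c by (intro mult_left_mono) auto
        ultimately show "t (T x) * ?c (e (T x)) + (1 - t (T x)) * ?c (e 0) \<le> \<epsilon> + 2 * r * (1 - t (T x))"
          by (simp add: mult.commute)
      qed
      finally show ?thesis .
    qed
    then have "(\<integral>\<^sup>+x. \<integral>\<^sup>+y. trunc_dist r x y \<partial>K x \<partial>\<mu>) \<le> (\<integral>\<^sup>+x. ennreal (\<epsilon> + 2 * r * (1 - t (T x))) \<partial>\<mu>)"
      by (intro nn_integral_mono)
    also have "\<dots> = ennreal (\<integral>x. \<epsilon> + 2 * r * (1 - t (T x)) \<partial>\<mu>)"
      using t r eps integrable_T[of t] by (intro nn_integral_eq_integral) (auto intro!: AE_I2)
    also have "(\<integral>x. \<epsilon> + 2 * r * (1 - t (T x)) \<partial>\<mu>) = \<epsilon> + 2 * r * (1 - s)"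
      using t integrable_T[of t] integral_t[of "\<lambda>_. 1"] mu.prob_space by (simp add: s_def)
    also have "\<dots> \<le> \<epsilon> + 4 * r * \<epsilon>"
      using mult_left_mono[of "1 - s" "2 * \<epsilon>" "2 * r"] s_ge r by simp
    finally show ?thesis by (simp add: ennreal_leI)
  qed
  then have "robust_wasserstein r \<mu> \<nu> \<le> \<epsilon> + 4 * r * \<epsilon>"
    unfolding \<nu>_def using r eps by (intro robust_wasserstein_le_kernel[OF r mu K]) auto
  moreover define b where "b i = q i + (if i = 0 then 1 - s else 0)" for i
  have sum_b: "(\<Sum>i<N. b i * f i) = (\<Sum>i<N. q i * f i) + (1 - s) * f 0" for f :: "nat \<Rightarrow> real"
  proof -
    have "(\<Sum>i<N. (if i = 0 then 1 - s else 0) * f i) = (\<Sum>i<N. if i = 0 then (1 - s) * f i else 0)"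
      by (intro sum.cong) auto
    then show ?thesis
      using N(1) by (simp add: b_def distrib_right sum.distrib)
  qed
  have b_sum: "(\<Sum>i<N. b i) = 1"
    using sum_b[of "\<lambda>_. 1"] by (simp add: s_def)
  have b_nonneg: "0 \<le> b i" for i
    using q[of i] s_le by (simp add: b_def)
  have "b i \<le> 1" if "i < N" for i
    using member_le_sum[of i "{..<N}" b] b_nonneg b_sum that by simp
  moreover have "s \<in> \<rat>" unfolding s_def by (intro Rats_sum q)
  then have "b i \<in> \<rat>" for i
    using q[of i] by (simp add: b_def)
  moreover have "measure \<nu> A = (\<Sum>i<N. b i * indicator A (e i))" if A: "A \<in> sets borel" for A
  proof -
    have "measure \<nu> A = (\<integral>x. measure (K x) A \<partial>\<mu>)"
      unfolding \<nu>_def using K' A by (rule mu.measure_bind)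
    also have "\<dots> = (\<integral>x. t (T x) * indicator A (e (T x)) + (1 - t (T x)) * indicator A (e 0) \<partial>\<mu>)"
      using t A by (simp add: K_def measure_two_point)
    also have "\<dots> = (\<integral>x. t (T x) * indicator A (e (T x)) \<partial>\<mu>) + (1 - s) * indicator A (e 0)"
      using t integrable_T[of t] integrable_T[of "\<lambda>i. t i * indicator A (e i)"] integral_t[of "\<lambda>_. 1"] mu.prob_space
      by (simp add: s_def abs_mult indicator_def)
    finally show ?thesis
      by (simp only: integral_t[of "\<lambda>i. indicator A (e i)"] sum_b[of "\<lambda>i. indicator A (e i)"])
  qed
  ultimately show thesis
    using b_nonneg by (intro that[of \<nu> N b, OF nu _ _ b_sum]) auto
qed

section \<open>A countable dense set of measures\<close>

lemma borel_probs_eqI: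
  assumes "\<mu> \<in> borel_probs" "\<nu> \<in> borel_probs" and "\<And>A. A \<in> sets borel \<Longrightarrow> measure \<mu> A = measure \<nu> A"
  shows "\<mu> = \<nu>"
proof (rule measure_eqI)
  interpret mu: prob_space \<mu> using assms by (simp add: borel_probs_def)
  interpret nu: prob_space \<nu> using assms by (simp add: borel_probs_def)
  show "emeasure \<mu> A = emeasure \<nu> A" if "A \<in> sets \<mu>" for A
    using assms that by (simp add: mu.emeasure_eq_measure nu.emeasure_eq_measure borel_probs_def)
qed (use assms in \<open>simp add: borel_probs_def\<close>)

text \<open>
  The support points are taken from one sequence to make this set countable;
  \<open>rational_finite_probs\<close> itself contains all point masses.
\<close>

definition rational_probs_on :: "(nat \<Rightarrow> 'a::topological_space) \<Rightarrow> 'a measure set" where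
  "rational_probs_on e = {\<nu> \<in> borel_probs. \<exists>N b. (\<forall>i<N. b i \<in> \<rat> \<inter> {0..1}) \<and> (\<Sum>i<N. b i) = 1 \<and>
     (\<forall>A\<in>sets borel. measure \<nu> A = (\<Sum>i<N. b i * indicator A (e i)))}"

lemma rational_probs_on_subset: "rational_probs_on e \<subseteq> rational_finite_probs"
proof
  fix \<nu> assume "\<nu> \<in> rational_probs_on e"
  then obtain N b where nu: "\<nu> \<in> borel_probs" and b: "\<And>i. i < N \<Longrightarrow> b i \<in> \<rat> \<inter> {0..1}" "(\<Sum>i<N. b i) = 1"
    and meas: "\<And>A. A \<in> sets borel \<Longrightarrow> measure \<nu> A = (\<Sum>i<N. b i * indicator A (e i))"
    unfolding rational_probs_on_def by blast
  have "\<forall>j\<in>{1..N}. b (j - 1) \<in> \<rat> \<inter> {0..1}" using b(1) by auto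
  moreover have "(\<Sum>j=1..N. b (j - 1)) = 1"
    using b(2) by (simp add: sum.atLeast1_atMost_eq)
  moreover have "\<forall>A\<in>sets borel. measure \<nu> A = (\<Sum>j=1..N. b (j - 1) * measure (return borel (e (j - 1))) A)"
    using meas by (simp add: sum.atLeast1_atMost_eq measure_return)
  ultimately show "\<nu> \<in> rational_finite_probs"
    unfolding rational_finite_probs_def using nu
    by (intro CollectI conjI exI[of _ N] exI[of _ "\<lambda>j. e (j - 1)"] exI[of _ "\<lambda>j. b (j - 1)"])
qed

text \<open>A member is determined by the finite list of its weights.\<close>

lemma countable_rational_probs_on: "countable (rational_probs_on e)"
proof -
  let ?is = "\<lambda>bs \<nu>. \<nu> \<in> borel_probs \<and>
    (\<forall>A\<in>sets borel. measure \<nu> A = (\<Sum>i<length bs. bs ! i * indicator A (e i)))"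
  have "rational_probs_on e \<subseteq> (\<lambda>bs. SOME \<nu>. ?is bs \<nu>) ` lists \<rat>"
  proof
    fix \<nu> assume "\<nu> \<in> rational_probs_on e"
    then obtain N b where nu: "\<nu> \<in> borel_probs" and b: "\<And>i. i < N \<Longrightarrow> b i \<in> \<rat>"
      and meas: "\<And>A. A \<in> sets borel \<Longrightarrow> measure \<nu> A = (\<Sum>i<N. b i * indicator A (e i))"
      unfolding rational_probs_on_def by blast
    define bs where "bs = map b [0..<N]"
    have is_nu: "?is bs \<nu>"
      using nu meas by (simp add: bs_def)
    have "(SOME \<nu>. ?is bs \<nu>) = \<nu>"
    proof (rule some_equality)
      show "?is bs \<nu>" by (rule is_nu)
      show "\<nu>' = \<nu>" if "?is bs \<nu>'" for \<nu>'
        using that is_nu by (intro borel_probs_eqI) auto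
    qed
    moreover have "bs \<in> lists \<rat>"
      using b by (auto simp: bs_def)
    ultimately show "\<nu> \<in> (\<lambda>bs. SOME \<nu>. ?is bs \<nu>) ` lists \<rat>" by blast
  qed
  then show ?thesis
    by (rule countable_subset) (intro countable_image countable_lists countable_rat)
qed

lemma rational_probs_on_dense:
  fixes \<mu> :: "'a::{metric_space, second_countable_topology} measure" and e :: "nat \<Rightarrow> 'a"
  assumes r: "r > 0" and mu: "\<mu> \<in> borel_probs" and eps: "\<epsilon> > 0"
    and e: "\<And>x \<delta>. \<delta> > 0 \<Longrightarrow> \<exists>n. dist x (e n) < \<delta>"
  shows "\<exists>\<nu>\<in>rational_probs_on e. robust_wasserstein r \<mu> \<nu> < \<epsilon>"
proof -
  define \<delta> where "\<delta> = \<epsilon> / (2 + 4 * r)"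
  have "\<delta> * (2 + 4 * r) = \<epsilon>"
    using r by (simp add: \<delta>_def)
  moreover have "\<delta> > 0"
    using eps r by (simp add: \<delta>_def)
  ultimately have delta: "\<delta> > 0" "\<delta> + 4 * r * \<delta> < \<epsilon>"
    by (simp_all add: algebra_simps)
  obtain \<nu> N b where "\<nu> \<in> borel_probs" "robust_wasserstein r \<mu> \<nu> \<le> \<delta> + 4 * r * \<delta>"
    "\<And>i. i < N \<Longrightarrow> b i \<in> \<rat> \<inter> {0..1}" "(\<Sum>i<N. b i) = 1"
    "\<And>A. A \<in> sets borel \<Longrightarrow> measure \<nu> A = (\<Sum>i<N. b i * indicator A (e i))"
    by (rule exists_rational_finite_close[OF r mu delta(1) e[OF delta(1)]]) blast
  then show ?thesis
    unfolding rational_probs_on_def using delta(2) by (intro bexI[of _ \<nu>]) auto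
qed

theorem theorem3p7:
  fixes r :: real and P :: "'a::polish_space measure set"
    and W :: "'a measure \<Rightarrow> 'a measure \<Rightarrow> real"
  assumes "r > 0" and "P = borel_probs" and "W = robust_wasserstein r"
  shows "Metric_space P W \<and>
         Metric_space.mcomplete P W \<and>
         separable_space (Metric_space.mtopology P W) \<and>
         Metric_space.mtopology P W closure_of rational_finite_probs = P"
proof -
  interpret W: Metric_space P W
    unfolding assms by (rule Metric_space_robust_wasserstein[OF \<open>r > 0\<close>])
  have complete: "W.mcomplete"
    unfolding assms by (rule mcomplete_robust_wasserstein[OF \<open>r > 0\<close>])
  obtain e :: "nat \<Rightarrow> 'a" where e: "\<And>x \<delta>. \<delta> > 0 \<Longrightarrow> \<exists>n. dist x (e n) < \<delta>"
    using obtain_dense_sequence by blast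
  have sub: "rational_probs_on e \<subseteq> P" "(rational_finite_probs :: 'a measure set) \<subseteq> P"
    unfolding assms by (auto simp: rational_probs_on_def rational_finite_probs_def)
  have dense: "W.mtopology closure_of rational_probs_on e = P"
  proof -
    have "\<exists>\<nu>\<in>rational_probs_on e. \<nu> \<in> W.mball \<mu> \<epsilon>" if "\<mu> \<in> P" "\<epsilon> > 0" for \<mu> \<epsilon>
    proof -
      have "\<mu> \<in> borel_probs" using that assms(2) by simp
      then obtain \<nu> where "\<nu> \<in> rational_probs_on e" "robust_wasserstein r \<mu> \<nu> < \<epsilon>"
        using rational_probs_on_dense[OF \<open>r > 0\<close> _ \<open>\<epsilon> > 0\<close>, of \<mu> e] e by auto
      then have "W \<mu> \<nu> < \<epsilon>" "\<nu> \<in> P"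
        using sub(1) by (auto simp: assms(3))
      then have "\<nu> \<in> W.mball \<mu> \<epsilon>"
        using that by simp
      then show ?thesis
        using \<open>\<nu> \<in> rational_probs_on e\<close> by blast
    qed
    then show ?thesis
      unfolding W.metric_closure_of by auto
  qed
  have "separable_space W.mtopology"
    unfolding separable_space_def
    using countable_rational_probs_on[of e] sub(1) dense by auto
  moreover have "W.mtopology closure_of rational_finite_probs = P"
    using closure_of_mono[OF rational_probs_on_subset[of e], of W.mtopology] dense
      closure_of_subset_topspace[of W.mtopology rational_finite_probs] by auto
  ultimately show ?thesis
    using complete W.Metric_space_axioms by blast
qed

end
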